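(* Let $f,g:\mathbb{R}\to\mathbb{R}$ satisfy: $f,g\in C^\infty(\mathbb{R})$; $f(0)=0$ and $f''(x)\ge 0$ for all $x\in\mathbb{R}$; $g(x)\ge 0$ for all $x\in\mathbb{R}$, and $g(x)=0$ if and only if $x=0$. Let $T>0$, $s>3/2$, and let $u\in C^0([0,T];H^s(\mathbb{R}))$ be a non-trivial (not identically vanishing) solution of $$u_t+f'(u)u_x+\partial_x\Lambda^{-2}\Big(g(u)+\frac{f''(u)}{2}u_x^2\Big)=0 .$$ Then there do not exist $t^\ast\in(0,T)$ and an interval $[a,b]\subseteq\mathbb{R}$, $a<b$, such that $u(t^\ast,x)=0$ for all $x\in[a,b]$ and $u_t(t^\ast,a)=u_t(t^\ast,b)$.
   Context: Functions are real-valued, $t$ denotes time and $x$ space. $\Lambda^{-2}=(1-\partial_x^2)^{-1}$ is the inverse Helmholtz operator: $\Lambda^{-2}h=p\ast h$ and $\partial_x\Lambda^{-2}h=(\partial_x p)\ast h$, where $p(x)=\tfrac12 e^{-|x|}$, $\partial_xp(x)=-\mathrm{sgn}(x)p(x)$ and $\ast$ is convolution in $x$. $H^s(\mathbb{R})$ is the usual Sobolev space. By local well-posedness theory such solutions also belong to $C^1([0,T];H^{s-1}(\mathbb{R}))$. *)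

theory Defs
  imports "HOL-Analysis.Analysis"
begin

definition smooth :: "(real \<Rightarrow> real) \<Rightarrow> bool" where
  "smooth f \<longleftrightarrow> (\<forall>k x. (deriv ^^ k) f field_differentiable at x)"

definition square_integrable :: "(real \<Rightarrow> 'b::{real_normed_vector, second_countable_topology}) \<Rightarrow> bool" where
  "square_integrable h \<longleftrightarrow> h \<in> borel_measurable lborel \<and> integrable lborel (\<lambda>x. (norm (h x))\<^sup>2)"

(* F is (a representative of) the unitary Fourier-Plancherel transform of h:
   the truncated Fourier integrals of h converge to F in the L^2 norm. *)
definition is_fourier_transform :: "(real \<Rightarrow> real) \<Rightarrow> (real \<Rightarrow> complex) \<Rightarrow> bool" where
  "is_fourier_transform h F \<longleftrightarrow> square_integrable h \<and> square_integrable F \<and>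
     ((\<lambda>R. \<integral>\<^sup>+ \<xi>. ennreal ((cmod (F \<xi> - 
          (LINT x:{-R..R}|lborel. of_real (h x) * cis (- (x * \<xi>))) / of_real (sqrt (2 * pi))))\<^sup>2) \<partial>lborel)
        \<longlongrightarrow> 0) at_top"

(* The transform is unique only up to null sets; it is used below only inside integrals. *)
definition fourier_transform :: "(real \<Rightarrow> real) \<Rightarrow> real \<Rightarrow> complex" where
  "fourier_transform h = (SOME F. is_fourier_transform h F)"

(* H^s(R) for s >= 0, as a set of functions rather than of classes modulo null sets. *)
definition sobolev :: "real \<Rightarrow> (real \<Rightarrow> real) set" where
  "sobolev s = {h. \<exists>F. is_fourier_transform h F \<and>
     integrable lborel (\<lambda>\<xi>. (1 + \<xi>\<^sup>2) powr s * (cmod (F \<xi>))\<^sup>2)}"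

definition sobolev_norm :: "real \<Rightarrow> (real \<Rightarrow> real) \<Rightarrow> real" where
  "sobolev_norm s h =
     sqrt (LINT \<xi>|lborel. (1 + \<xi>\<^sup>2) powr s * (cmod (fourier_transform h \<xi>))\<^sup>2)"

definition continuous_into_sobolev :: "real \<Rightarrow> real \<Rightarrow> (real \<Rightarrow> real \<Rightarrow> real) \<Rightarrow> bool" where
  "continuous_into_sobolev T s u \<longleftrightarrow>
     (\<forall>t\<in>{0..T}. u t \<in> sobolev s) \<and>
     (\<forall>t\<^sub>0\<in>{0..T}. ((\<lambda>t. sobolev_norm s (\<lambda>x. u t x - u t\<^sub>0 x)) \<longlongrightarrow> 0) (at t\<^sub>0 within {0..T}))"

definition helmholtz_kernel :: "real \<Rightarrow> real" where
  "helmholtz_kernel x = exp (- \<bar>x\<bar>) / 2"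

definition convolution :: "(real \<Rightarrow> real) \<Rightarrow> (real \<Rightarrow> real) \<Rightarrow> real \<Rightarrow> real" where
  "convolution k h x = (LINT y|lborel. k (x - y) * h y)"

(* The operator d/dx (1 - d^2/dx^2)^{-1}, i.e. convolution with the derivative of the kernel. *)
definition dx_inv_helmholtz :: "(real \<Rightarrow> real) \<Rightarrow> real \<Rightarrow> real" where
  "dx_inv_helmholtz h = convolution (\<lambda>x. - sgn x * helmholtz_kernel x) h"

(* For s > 3/2 one has H^s(R) inside C^1(R) and H^(s-1)(R) inside C^0(R). So u(t) is taken to be
   the continuous representative of its class, the spatial derivative is then classical, and the
   equation, whose terms are continuous functions, is required to hold at every point. *)
definition is_solution ::
  "(real \<Rightarrow> real) \<Rightarrow> (real \<Rightarrow> real) \<Rightarrow> real \<Rightarrow> real \<Rightarrow> (real \<Rightarrow> real \<Rightarrow> real) \<Rightarrow> bool" where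
  "is_solution f g T s u \<longleftrightarrow>
     continuous_into_sobolev T s u \<and>
     (\<forall>t\<in>{0..T}. continuous_on UNIV (u t)) \<and>
     (\<forall>t\<in>{0<..<T}. \<forall>x. (\<lambda>\<tau>. u \<tau> x) field_differentiable at t \<and>
        deriv (\<lambda>\<tau>. u \<tau> x) t + deriv f (u t x) * deriv (u t) x
        + dx_inv_helmholtz
            (\<lambda>y. g (u t y) + deriv (deriv f) (u t y) / 2 * (deriv (u t) y)\<^sup>2) x = 0)"

end

theory Submission
  imports Defs "HOL-Probability.Probability" "HOL-Real_Asymp.Real_Asymp"
begin

text \<open>Where \<open>u\<close> vanishes on \<open>[a, b]\<close> at time \<open>t\<close>, the equation reduces to \<open>u\<^sub>t = - \<partial>\<^sub>x \<Lambda>\<^sup>-\<^sup>2 h\<close> with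
  \<open>h = g(u) + f''(u) u\<^sub>x\<^sup>2 / 2 \<ge> 0\<close> and \<open>h = 0\<close> on \<open>[a, b]\<close>. The kernel \<open>\<partial>\<^sub>x p\<close> increases except for its jump
  at 0, so equality of \<open>u\<^sub>t\<close> at \<open>a\<close> and \<open>b\<close> forces \<open>h = 0\<close> everywhere, hence \<open>u(t, \<cdot>) = 0\<close>. It remains to
  propagate the zero state in both time directions. Near a time at which \<open>u\<close> vanishes, its \<open>W\<^sup>1\<^sup>,\<^sup>\<infinity>\<close> norm is
  small by the Sobolev embedding; regarding the nonlocal term as a source of a transport equation, the source
  controls the \<open>W\<^sup>1\<^sup>,\<^sup>\<infinity>\<close> norm of \<open>u\<close> over short times with a small factor, and is controlled by that norm,
  so both vanish. The embedding rests on pointwise Fourier inversion of continuous functions with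
  integrable Plancherel transform, obtained by testing the transform with Gaussians.\<close>

subsection \<open>Fourier inversion\<close>

text \<open>Only one space derivative of \<open>u\<close> is at hand, so \<open>u_x\<close> cannot
  be estimated by differentiating the equation; yet the source contains \<open>u_x^2\<close>, so a
  bound on \<open>u\<close> alone does not close. Two facts resolve this. Convolution with
  \<open>dx_kernel\<close> turns a merely bounded source into a Lipschitz function, and for a
  transport equation started from 0 a Lipschitz bound follows from a maximum principle in two space
  variables. Both the sup bound and the Lipschitz bound grow linearly in time, which is where the
  small factor comes from. Short times suffice: the zero times form a subset of
  \<open>(0, T)\<close> that is open and relatively closed, and the endpoints follow from continuity
  in the norm. The Fourier part is shaped by the definition: a transform is an L^2 limit, known only
  up to null sets. Point values of \<open>h\<close> are therefore reached by pairing. A Gaussian is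
  square integrable, it justifies Fubini on the truncated integrals, and its own transform is a
  Gaussian that concentrates at a point.\<close>

lemma cis_measurable [measurable]: "cis \<in> borel_measurable borel"
  by (intro borel_measurable_continuous_onI continuous_intros)

text \<open>Both claims come from the inequality for extended nonnegative integrals: its finite
  right side gives integrability, after which the integrals can be read as real ones.\<close>

lemma
  fixes f g :: "'a \<Rightarrow> real"
  assumes [measurable]: "f \<in> borel_measurable M" "g \<in> borel_measurable M"
    and f2: "integrable M (\<lambda>x. (f x)\<^sup>2)" and g2: "integrable M (\<lambda>x. (g x)\<^sup>2)"
  shows integrable_mult_L2: "integrable M (\<lambda>x. f x * g x)"
    and Cauchy_Schwarz_L2: "(LINT x|M. \<bar>f x * g x\<bar>) \<le> sqrt (LINT x|M. (f x)\<^sup>2) * sqrt (LINT x|M. (g x)\<^sup>2)"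
proof -
  have "(\<integral>\<^sup>+x. ennreal \<bar>f x * g x\<bar> \<partial>M)\<^sup>2 = (\<integral>\<^sup>+x. ennreal \<bar>f x\<bar> * ennreal \<bar>g x\<bar> \<partial>M)\<^sup>2"
    by (simp add: abs_mult ennreal_mult)
  also have "\<dots> \<le> (\<integral>\<^sup>+x. (ennreal \<bar>f x\<bar>)\<^sup>2 \<partial>M) * (\<integral>\<^sup>+x. (ennreal \<bar>g x\<bar>)\<^sup>2 \<partial>M)"
    by (intro Cauchy_Schwarz_nn_integral) auto
  also have "\<dots> = ennreal (LINT x|M. (f x)\<^sup>2) * ennreal (LINT x|M. (g x)\<^sup>2)"
    by (simp add: ennreal_power nn_integral_eq_integral f2 g2)
  finally have *: "(\<integral>\<^sup>+x. ennreal \<bar>f x * g x\<bar> \<partial>M)\<^sup>2 \<le> ennreal ((LINT x|M. (f x)\<^sup>2) * (LINT x|M. (g x)\<^sup>2))"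
    by (simp add: ennreal_mult)
  then have "(\<integral>\<^sup>+x. ennreal \<bar>f x * g x\<bar> \<partial>M) < \<infinity>"
    by (metis ennreal_less_top infinity_ennreal_def order_le_less_trans power_less_top_ennreal zero_neq_numeral)
  then show int: "integrable M (\<lambda>x. f x * g x)"
    by (simp add: integrable_iff_bounded)
  have "ennreal ((LINT x|M. \<bar>f x * g x\<bar>)\<^sup>2) \<le> ennreal ((LINT x|M. (f x)\<^sup>2) * (LINT x|M. (g x)\<^sup>2))"
    using * int by (simp add: nn_integral_eq_integral ennreal_power)
  then have "(LINT x|M. \<bar>f x * g x\<bar>)\<^sup>2 \<le> (LINT x|M. (f x)\<^sup>2) * (LINT x|M. (g x)\<^sup>2)"
    by (simp add: ennreal_le_iff)
  then show "(LINT x|M. \<bar>f x * g x\<bar>) \<le> sqrt (LINT x|M. (f x)\<^sup>2) * sqrt (LINT x|M. (g x)\<^sup>2)"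
    by (simp add: real_le_rsqrt flip: real_sqrt_mult)
qed

text \<open>This is the characteristic function of the standard normal distribution at
  \<open>z / \<sigma>\<close>, after rescaling the integration variable by
  \<open>\<sigma>\<close>.\<close>

lemma
  fixes \<sigma> z :: real
  assumes "\<sigma> > 0"
  shows integrable_gaussian: "integrable lborel (\<lambda>\<xi>. exp (- (\<sigma> * \<xi>)\<^sup>2 / 2))"
    and fourier_gaussian: "(LINT \<xi>|lborel. cis (z * \<xi>) * of_real (exp (- (\<sigma> * \<xi>)\<^sup>2 / 2)))
        = of_real (sqrt (2 * pi) / \<sigma> * exp (- z\<^sup>2 / (2 * \<sigma>\<^sup>2)))"
proof -
  have "integrable lborel (\<lambda>\<xi>. sqrt (2 * pi) * std_normal_density (0 + \<sigma> * \<xi>))"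
    using assms by (intro integrable_mult_right) (subst lborel_integrable_real_affine_iff, auto intro: integrable_normal_density)
  then show "integrable lborel (\<lambda>\<xi>. exp (- (\<sigma> * \<xi>)\<^sup>2 / 2))"
    by (simp add: std_normal_density_def)
  have "of_real (exp (- (z / \<sigma>)\<^sup>2 / 2)) = char std_normal_distribution (z / \<sigma>)"
    by (simp add: char_std_normal_distribution)
  also have "\<dots> = (LINT x|lborel. std_normal_density x *\<^sub>R iexp (z / \<sigma> * x))"
    unfolding char_def by (subst integral_density) auto
  also have "\<dots> = \<sigma> *\<^sub>R (LINT x|lborel. std_normal_density (\<sigma> * x) *\<^sub>R iexp (z * x))"
    using assms by (subst lborel_integral_real_affine[where c = \<sigma> and t = 0]) auto
  also have "(LINT x|lborel. std_normal_density (\<sigma> * x) *\<^sub>R iexp (z * x)) =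
     (LINT \<xi>|lborel. cis (z * \<xi>) * of_real (exp (- (\<sigma> * \<xi>)\<^sup>2 / 2)) / of_real (sqrt (2 * pi)))"
    by (intro Bochner_Integration.integral_cong) (auto simp: std_normal_density_def cis_conv_exp scaleR_conv_of_real)
  finally have *: "of_real (exp (- (z / \<sigma>)\<^sup>2 / 2)) =
     \<sigma> *\<^sub>R ((LINT \<xi>|lborel. cis (z * \<xi>) * of_real (exp (- (\<sigma> * \<xi>)\<^sup>2 / 2))) / of_real (sqrt (2 * pi)))"
    by (subst (asm) Bochner_Integration.integral_divide_zero)
  have "\<sigma> \<noteq> 0" "complex_of_real (sqrt (2 * pi)) \<noteq> 0" using assms by simp_all
  then show "(LINT \<xi>|lborel. cis (z * \<xi>) * of_real (exp (- (\<sigma> * \<xi>)\<^sup>2 / 2)))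
        = of_real (sqrt (2 * pi) / \<sigma> * exp (- z\<^sup>2 / (2 * \<sigma>\<^sup>2)))"
    using arg_cong[OF *, of "\<lambda>w. w * of_real (sqrt (2 * pi)) / of_real \<sigma>"]
    by (simp add: scaleR_conv_of_real power_divide mult_ac del: of_real_mult of_real_divide)
       (simp add: of_real_mult of_real_divide)
qed

section \<open>Truncated transforms, and pairing the Plancherel transform with Gaussians\<close>

definition truncated_fourier :: "(real \<Rightarrow> real) \<Rightarrow> real \<Rightarrow> real \<Rightarrow> complex" where
  "truncated_fourier h R \<xi> =
     (LINT x:{-R..R}|lborel. of_real (h x) * cis (- (x * \<xi>))) / of_real (sqrt (2 * pi))"

text \<open>Truncation makes \<open>h\<close> integrable and the Gaussian makes the frequency
  integral converge, so Fubini applies. The inner integral over \<open>\<xi>\<close> is then again a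
  Gaussian, namely a normal density centred at \<open>x\<close>.\<close>

lemma
  fixes h :: "real \<Rightarrow> real" and R :: real
  assumes [measurable]: "h \<in> borel_measurable borel" and h2: "integrable lborel (\<lambda>x. (h x)\<^sup>2)"
  shows truncated_fourier_measurable: "truncated_fourier h R \<in> borel_measurable borel"
    and truncated_fourier_gaussian:
      "\<sigma> > 0 \<Longrightarrow> integrable lborel (\<lambda>\<xi>. truncated_fourier h R \<xi> * (cis (x * \<xi>) * of_real (exp (- (\<sigma> * \<xi>)\<^sup>2 / 2))))"
      "\<sigma> > 0 \<Longrightarrow> (LINT \<xi>|lborel. truncated_fourier h R \<xi> * (cis (x * \<xi>) * of_real (exp (- (\<sigma> * \<xi>)\<^sup>2 / 2)))) / of_real (sqrt (2 * pi))
        = of_real (LINT y|lborel. indicator {-R..R} y * (h y * normal_density x \<sigma> y))"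
proof -
  define G where "G = truncated_fourier h R"
  have G: "G = (\<lambda>\<xi>. (LINT y|lborel. indicator {-R..R} y *\<^sub>R (of_real (h y) * cis (- (y * \<xi>)))) / of_real (sqrt (2 * pi)))"
    by (simp add: G_def truncated_fourier_def[abs_def] set_lebesgue_integral_def)
  have Gm [measurable]: "G \<in> borel_measurable borel"
    unfolding G by measurable
  then show "truncated_fourier h R \<in> borel_measurable borel" by (simp add: G_def)
  assume \<sigma>: "\<sigma> > 0"
  define g where "g \<xi> = exp (- (\<sigma> * \<xi>)\<^sup>2 / 2)" for \<xi> :: real
  have g_m [measurable]: "g \<in> borel_measurable borel" unfolding g_def by measurable
  have g_int: "integrable lborel g" unfolding g_def by (rule integrable_gaussian[OF \<sigma>])
  have g_pos: "g \<xi> \<ge> 0" for \<xi> by (simp add: g_def)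
  define H where "H y = indicator {-R..R} y * h y" for y
  have H_m [measurable]: "H \<in> borel_measurable borel" unfolding H_def by measurable
  have "integrable lborel (\<lambda>y. (indicator {-R..R} y)\<^sup>2 :: real)"
    by (auto simp: power2_eq_square emeasure_lborel_Icc_eq simp flip: indicator_inter_arith)
  \<comment> \<open>On a bounded interval L^2 lies in L^1, by Cauchy-Schwarz against the
    indicator.\<close>
  then have H_int: "integrable lborel H"
    using integrable_mult_L2[of "indicator {-R..R}" lborel h] h2 by (simp add: H_def[abs_def])
  have GH: "G \<xi> = (LINT y|lborel. of_real (H y) * cis (- (y * \<xi>))) / of_real (sqrt (2 * pi))" for \<xi>
    unfolding G H_def by (simp add: scaleR_conv_of_real mult_ac)
  have bound: "cmod (G \<xi>) \<le> (LINT y|lborel. \<bar>H y\<bar>) / sqrt (2 * pi)" for \<xi>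
  proof -
    have "cmod (LINT y|lborel. of_real (H y) * cis (- (y * \<xi>))) \<le> (LINT y|lborel. cmod (of_real (H y) * cis (- (y * \<xi>))))"
      by (rule integral_norm_bound)
    then show ?thesis by (simp add: GH norm_divide norm_mult divide_right_mono)
  qed
  have G_int: "integrable lborel (\<lambda>\<xi>. G \<xi> * (cis (x * \<xi>) * of_real (exp (- (\<sigma> * \<xi>)\<^sup>2 / 2))))"
  proof (rule Bochner_Integration.integrable_bound)
    show "integrable lborel (\<lambda>\<xi>. (LINT y|lborel. \<bar>H y\<bar>) / sqrt (2 * pi) * g \<xi>)"
      by (intro integrable_mult_right g_int)
    show "AE \<xi> in lborel. norm (G \<xi> * (cis (x * \<xi>) * of_real (exp (- (\<sigma> * \<xi>)\<^sup>2 / 2))))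
        \<le> norm ((LINT y|lborel. \<bar>H y\<bar>) / sqrt (2 * pi) * g \<xi>)"
      using mult_right_mono[OF bound g_pos] by (simp add: norm_mult g_def)
  qed measurable
  then show "integrable lborel (\<lambda>\<xi>. truncated_fourier h R \<xi> * (cis (x * \<xi>) * of_real (exp (- (\<sigma> * \<xi>)\<^sup>2 / 2))))"
    by (simp add: G_def)
  have F_int: "integrable (lborel \<Otimes>\<^sub>M lborel) (\<lambda>(y, \<xi>). of_real (H y) * (cis ((x - y) * \<xi>) * complex_of_real (g \<xi>)))"
  proof (rule lborel_pair.Fubini_integrable, goal_cases)
    case 2
    have "integrable lborel (\<lambda>y. \<bar>H y\<bar> * (LINT \<xi>|lborel. g \<xi>))"
      using H_int by (intro integrable_mult_left) auto
    then show ?case using g_pos by (simp add: norm_mult)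
  next
    case 3
    have "integrable lborel (\<lambda>\<xi>. of_real (H y) * (cis ((x - y) * \<xi>) * complex_of_real (g \<xi>)))" for y
      by (rule Bochner_Integration.integrable_bound[OF integrable_mult_right[OF g_int, of "H y"]])
         (auto simp: norm_mult)
    then show ?case by simp
  qed measurable
  have "(LINT \<xi>|lborel. G \<xi> * (cis (x * \<xi>) * of_real (g \<xi>)))
     = (LINT \<xi>|lborel. (LINT y|lborel. of_real (H y) * (cis ((x - y) * \<xi>) * of_real (g \<xi>)))) / of_real (sqrt (2 * pi))"
  proof -
    have "G \<xi> * (cis (x * \<xi>) * of_real (g \<xi>)) =
      (LINT y|lborel. of_real (H y) * (cis ((x - y) * \<xi>) * of_real (g \<xi>))) / of_real (sqrt (2 * pi))" for \<xi>
    proof -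
      have "cis ((x - y) * \<xi>) = cis (- (y * \<xi>)) * cis (x * \<xi>)" for y
        by (simp add: cis_mult algebra_simps)
      then have "(LINT y|lborel. of_real (H y) * (cis ((x - y) * \<xi>) * of_real (g \<xi>))) =
         (LINT y|lborel. of_real (H y) * cis (- (y * \<xi>)) * (cis (x * \<xi>) * of_real (g \<xi>)))"
        by (intro Bochner_Integration.integral_cong refl) (simp add: mult_ac)
      then show ?thesis unfolding GH by simp
    qed
    then show ?thesis by simp
  qed
  also have "(LINT \<xi>|lborel. (LINT y|lborel. of_real (H y) * (cis ((x - y) * \<xi>) * of_real (g \<xi>))))
     = (LINT y|lborel. (LINT \<xi>|lborel. of_real (H y) * (cis ((x - y) * \<xi>) * of_real (g \<xi>))))"
    by (rule lborel_pair.Fubini_integral[OF F_int])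
  also have "\<dots> = (LINT y|lborel. of_real (H y * (sqrt (2 * pi) / \<sigma> * exp (- (x - y)\<^sup>2 / (2 * \<sigma>\<^sup>2)))))"
    by (simp only: g_def integral_mult_right_zero fourier_gaussian[OF \<sigma>] of_real_mult)
  \<comment> \<open>The factor \<open>2 * pi\<close> will cancel against two factors
    \<open>sqrt (2 * pi)\<close>: one from the unitary transform, one from the inversion
    formula.\<close>
  also have "\<dots> = (LINT y|lborel. of_real (2 * pi * (H y * normal_density x \<sigma> y)))"
  proof (intro Bochner_Integration.integral_cong refl arg_cong[where f = of_real])
    fix y
    have "sqrt (2 * pi) / \<sigma> = 2 * pi * (1 / sqrt (2 * pi * \<sigma>\<^sup>2))"
      using \<sigma> real_sqrt_mult_self[of "2 * pi"] by (simp add: real_sqrt_mult field_simps)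
    then show "H y * (sqrt (2 * pi) / \<sigma> * exp (- (x - y)\<^sup>2 / (2 * \<sigma>\<^sup>2))) = 2 * pi * (H y * normal_density x \<sigma> y)"
      by (simp add: normal_density_def power2_commute[of x y])
  qed
  also have "\<dots> = of_real (2 * pi * (LINT y|lborel. H y * normal_density x \<sigma> y))"
    by (simp only: integral_complex_of_real integral_mult_right_zero)
  finally have "(LINT \<xi>|lborel. G \<xi> * (cis (x * \<xi>) * of_real (g \<xi>))) / of_real (sqrt (2 * pi)) =
     of_real (2 * pi * (LINT y|lborel. H y * normal_density x \<sigma> y)) / of_real (sqrt (2 * pi)) / of_real (sqrt (2 * pi))"
    by (rule arg_cong)
  also have "\<dots> = of_real (2 * pi * (LINT y|lborel. H y * normal_density x \<sigma> y) / (sqrt (2 * pi) * sqrt (2 * pi)))"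
    by (simp only: of_real_divide of_real_mult divide_divide_eq_left)
  also have "2 * pi * (LINT y|lborel. H y * normal_density x \<sigma> y) / (sqrt (2 * pi) * sqrt (2 * pi))
      = (LINT y|lborel. H y * normal_density x \<sigma> y)"
    by (simp only: real_sqrt_mult_self) simp
  finally show "(LINT \<xi>|lborel. truncated_fourier h R \<xi> * (cis (x * \<xi>) * of_real (exp (- (\<sigma> * \<xi>)\<^sup>2 / 2)))) / of_real (sqrt (2 * pi))
        = of_real (LINT y|lborel. indicator {-R..R} y * (h y * normal_density x \<sigma> y))"
    by (simp add: G_def g_def H_def mult_ac)
qed

lemma is_fourier_transformD:
  assumes "is_fourier_transform h F"
  shows "h \<in> borel_measurable borel" "F \<in> borel_measurable borel"
    "integrable lborel (\<lambda>x. (h x)\<^sup>2)" "integrable lborel (\<lambda>\<xi>. (cmod (F \<xi>))\<^sup>2)"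
    "((\<lambda>R. \<integral>\<^sup>+ \<xi>. ennreal ((cmod (F \<xi> - truncated_fourier h R \<xi>))\<^sup>2) \<partial>lborel) \<longlongrightarrow> 0) at_top"
  using assms by (auto simp: is_fourier_transform_def square_integrable_def truncated_fourier_def)

text \<open>Both candidates are L^2 limits of the same truncated transforms. Uniqueness lets the
  transform selected by \<open>SOME\<close> inherit properties known for some other
  representative.\<close>

lemma is_fourier_transform_unique:
  assumes "is_fourier_transform h F" "is_fourier_transform h F'"
  shows "AE \<xi> in lborel. F \<xi> = F' \<xi>"
proof -
  note [measurable] = is_fourier_transformD(1,2)[OF assms(1)] is_fourier_transformD(2)[OF assms(2)]
    truncated_fourier_measurable[OF is_fourier_transformD(1,3)[OF assms(1)]]
  let ?e = "\<lambda>F R. \<integral>\<^sup>+ \<xi>. ennreal ((cmod (F \<xi> - truncated_fourier h R \<xi>))\<^sup>2) \<partial>lborel"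
  have le: "(\<integral>\<^sup>+ \<xi>. ennreal ((cmod (F \<xi> - F' \<xi>))\<^sup>2) \<partial>lborel) \<le> 2 * ?e F R + 2 * ?e F' R" for R
  proof -
    have *: "(cmod (a - b))\<^sup>2 \<le> 2 * (cmod (a - c))\<^sup>2 + 2 * (cmod (b - c))\<^sup>2" for a b c
    proof -
      have "(cmod (a - b))\<^sup>2 \<le> (cmod (a - c) + cmod (b - c))\<^sup>2"
        by (intro power_mono) (metis norm_minus_commute norm_triangle_sub dist_norm dist_triangle2, simp)
      also have "\<dots> \<le> 2 * (cmod (a - c))\<^sup>2 + 2 * (cmod (b - c))\<^sup>2"
        using sum_squares_bound[of "cmod (a - c)" "cmod (b - c)"] by (simp add: power2_sum)
      finally show ?thesis .
    qed
    have "(\<integral>\<^sup>+ \<xi>. ennreal ((cmod (F \<xi> - F' \<xi>))\<^sup>2) \<partial>lborel)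
      \<le> (\<integral>\<^sup>+ \<xi>. 2 * ennreal ((cmod (F \<xi> - truncated_fourier h R \<xi>))\<^sup>2) + 2 * ennreal ((cmod (F' \<xi> - truncated_fourier h R \<xi>))\<^sup>2) \<partial>lborel)"
      proof (intro nn_integral_mono)
      fix \<xi>
      show "ennreal ((cmod (F \<xi> - F' \<xi>))\<^sup>2) \<le> 2 * ennreal ((cmod (F \<xi> - truncated_fourier h R \<xi>))\<^sup>2) + 2 * ennreal ((cmod (F' \<xi> - truncated_fourier h R \<xi>))\<^sup>2)"
        using ennreal_leI[OF *[of "F \<xi>" "F' \<xi>" "truncated_fourier h R \<xi>"]] by (simp add: ennreal_mult)
    qed
    also have "\<dots> = 2 * ?e F R + 2 * ?e F' R"
      by (simp add: nn_integral_add nn_integral_cmult)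
    finally show ?thesis .
  qed
  have "((\<lambda>R. 2 * ?e F R + 2 * ?e F' R) \<longlongrightarrow> 2 * 0 + 2 * 0) at_top"
    by (intro tendsto_add ennreal_tendsto_cmult is_fourier_transformD(5) assms) auto
  then have "(\<integral>\<^sup>+ \<xi>. ennreal ((cmod (F \<xi> - F' \<xi>))\<^sup>2) \<partial>lborel) \<le> 2 * 0 + 2 * 0"
    by (rule tendsto_lowerbound) (use le in auto)
  then show ?thesis
    by (subst (asm) mult_zero_right, simp add: nn_integral_0_iff_AE)
qed

text \<open>The truncated identity passes to the limit on both sides: on the frequency side by
  Cauchy-Schwarz, since the Gaussian is in L^2, and on the space side by dominated
  convergence.\<close>

lemma fourier_gaussian_pairing:
  assumes ft: "is_fourier_transform h F" and \<sigma>: "\<sigma> > 0"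
  shows "(LINT \<xi>|lborel. F \<xi> * (cis (x * \<xi>) * of_real (exp (- (\<sigma> * \<xi>)\<^sup>2 / 2)))) / of_real (sqrt (2 * pi))
        = of_real (LINT y|lborel. h y * normal_density x \<sigma> y)"
proof (rule LIMSEQ_unique)
  note [measurable] = is_fourier_transformD(1,2)[OF ft] truncated_fourier_measurable[OF is_fourier_transformD(1,3)[OF ft]]
  note h2 = is_fourier_transformD(3)[OF ft]
  let ?G = "truncated_fourier h"
  define g where "g \<xi> = exp (- (\<sigma> * \<xi>)\<^sup>2 / 2)" for \<xi> :: real
  have g_m [measurable]: "g \<in> borel_measurable borel" unfolding g_def by measurable
  have g2: "integrable lborel (\<lambda>\<xi>. (g \<xi>)\<^sup>2)"
  proof (rule Bochner_Integration.integrable_bound[OF integrable_gaussian[OF \<sigma>]])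
    show "AE \<xi> in lborel. norm ((g \<xi>)\<^sup>2) \<le> norm (exp (- (\<sigma> * \<xi>)\<^sup>2 / 2))"
      by (simp add: g_def power2_eq_square mult_le_cancel_right1)
  qed measurable
  let ?\<phi> = "\<lambda>\<xi>. cis (x * \<xi>) * complex_of_real (g \<xi>)"
  have F_int: "integrable lborel (\<lambda>\<xi>. F \<xi> * ?\<phi> \<xi>)"
  proof (rule Bochner_Integration.integrable_bound)
    show "integrable lborel (\<lambda>\<xi>. cmod (F \<xi>) * g \<xi>)"
      by (rule integrable_mult_L2) (use g2 is_fourier_transformD(4)[OF ft] in auto)
  qed (auto simp: norm_mult)
  have G_int: "integrable lborel (\<lambda>\<xi>. ?G R \<xi> * ?\<phi> \<xi>)" for R
    unfolding g_def by (rule truncated_fourier_gaussian) (use \<sigma> h2 in auto)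
  let ?e = "\<lambda>R. \<integral>\<^sup>+ \<xi>. ennreal ((cmod (F \<xi> - ?G R \<xi>))\<^sup>2) \<partial>lborel"
  have e: "(\<lambda>n. ?e (real n)) \<longlonglongrightarrow> 0"
    using is_fourier_transformD(5)[OF ft] filterlim_real_sequentially by (rule filterlim_compose)
  have "(\<lambda>n. (LINT \<xi>|lborel. F \<xi> * ?\<phi> \<xi>) - (LINT \<xi>|lborel. ?G (real n) \<xi> * ?\<phi> \<xi>)) \<longlonglongrightarrow> 0"
  proof (rule Lim_null_comparison)
    show "\<forall>\<^sub>F n in sequentially. norm ((LINT \<xi>|lborel. F \<xi> * ?\<phi> \<xi>) - (LINT \<xi>|lborel. ?G (real n) \<xi> * ?\<phi> \<xi>))
        \<le> sqrt (enn2real (?e (real n))) * sqrt (LINT \<xi>|lborel. (g \<xi>)\<^sup>2)"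
      \<comment> \<open>Any finite threshold would do: a finite error makes the difference square
        integrable, as Cauchy-Schwarz requires.\<close>
      using order_tendstoD(2)[OF e, of 1, simplified]
    proof eventually_elim
      case (elim n)
      define d where "d \<xi> = cmod (F \<xi> - ?G (real n) \<xi>)" for \<xi>
      have d_m [measurable]: "d \<in> borel_measurable borel" unfolding d_def by measurable
      have d2: "integrable lborel (\<lambda>\<xi>. (d \<xi>)\<^sup>2)"
        using elim by (intro integrableI_bounded) (auto simp: d_def less_top[symmetric] intro: order.strict_trans)
      have "norm ((LINT \<xi>|lborel. F \<xi> * ?\<phi> \<xi>) - (LINT \<xi>|lborel. ?G (real n) \<xi> * ?\<phi> \<xi>))
          = norm (LINT \<xi>|lborel. (F \<xi> - ?G (real n) \<xi>) * ?\<phi> \<xi>)"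
        using F_int G_int by (simp add: left_diff_distrib)
      also have "\<dots> \<le> (LINT \<xi>|lborel. norm ((F \<xi> - ?G (real n) \<xi>) * ?\<phi> \<xi>))"
        by (rule integral_norm_bound)
      also have "\<dots> = (LINT \<xi>|lborel. \<bar>d \<xi> * g \<xi>\<bar>)"
        by (simp add: norm_mult d_def abs_mult)
      also have "\<dots> \<le> sqrt (LINT \<xi>|lborel. (d \<xi>)\<^sup>2) * sqrt (LINT \<xi>|lborel. (g \<xi>)\<^sup>2)"
        by (rule Cauchy_Schwarz_L2) (use d2 g2 in auto)
      also have "(LINT \<xi>|lborel. (d \<xi>)\<^sup>2) = enn2real (?e (real n))"
        using d2 by (simp add: integral_eq_nn_integral d_def)
      finally show ?case .
    qed
    have "(\<lambda>n. enn2real (?e (real n))) \<longlonglongrightarrow> 0"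
      using tendsto_enn2real[of _ 0] e by simp
    then show "(\<lambda>n. sqrt (enn2real (?e (real n))) * sqrt (LINT \<xi>|lborel. (g \<xi>)\<^sup>2)) \<longlonglongrightarrow> 0"
      by (intro tendsto_mult_left_zero) (use tendsto_real_sqrt in force)
  qed
  then have "(\<lambda>n. (LINT \<xi>|lborel. ?G (real n) \<xi> * ?\<phi> \<xi>)) \<longlonglongrightarrow> (LINT \<xi>|lborel. F \<xi> * ?\<phi> \<xi>)"
    by (rule Lim_transform2[OF tendsto_const])
  then show "(\<lambda>n. (LINT \<xi>|lborel. ?G (real n) \<xi> * ?\<phi> \<xi>) / of_real (sqrt (2 * pi))) \<longlonglongrightarrow>
    (LINT \<xi>|lborel. F \<xi> * (cis (x * \<xi>) * of_real (exp (- (\<sigma> * \<xi>)\<^sup>2 / 2)))) / of_real (sqrt (2 * pi))"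
    by (intro tendsto_divide tendsto_const) (auto simp: g_def)
  have N2: "integrable lborel (\<lambda>y. (normal_density x \<sigma> y)\<^sup>2)"
  proof (rule Bochner_Integration.integrable_bound)
    show "integrable lborel (\<lambda>y. 1 / sqrt (2 * pi * \<sigma>\<^sup>2) * normal_density x \<sigma> y)"
      using \<sigma> by (intro integrable_mult_right) auto
  qed (auto simp: power2_eq_square normal_density_def intro!: mult_mono divide_left_mono divide_right_mono)
  have hN: "integrable lborel (\<lambda>y. h y * normal_density x \<sigma> y)"
    by (rule integrable_mult_L2) (use h2 N2 in auto)
  have "(\<lambda>n. (LINT y|lborel. indicator {-real n..real n} y * (h y * normal_density x \<sigma> y)))
      \<longlonglongrightarrow> (LINT y|lborel. h y * normal_density x \<sigma> y)"
  proof (rule integral_dominated_convergence[where w = "\<lambda>y. \<bar>h y * normal_density x \<sigma> y\<bar>"])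
    show "AE y in lborel. (\<lambda>n. indicator {-real n..real n} y * (h y * normal_density x \<sigma> y)) \<longlonglongrightarrow> h y * normal_density x \<sigma> y"
    proof (intro AE_I2 tendsto_eventually)
      fix y :: real
      obtain N :: nat where "\<bar>y\<bar> \<le> real N" using real_arch_simple by blast
      then show "\<forall>\<^sub>F n in sequentially. indicator {-real n..real n} y * (h y * normal_density x \<sigma> y) = h y * normal_density x \<sigma> y"
        by (auto simp: eventually_sequentially indicator_def intro!: exI[of _ N])
    qed
  qed (use hN integrable_abs[OF hN] in \<open>auto simp: indicator_def\<close>)
  then have "(\<lambda>n. complex_of_real (LINT y|lborel. indicator {-real n..real n} y * (h y * normal_density x \<sigma> y)))
      \<longlonglongrightarrow> of_real (LINT y|lborel. h y * normal_density x \<sigma> y)"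
    by (rule tendsto_of_real)
  then show "(\<lambda>n. (LINT \<xi>|lborel. ?G (real n) \<xi> * ?\<phi> \<xi>) / of_real (sqrt (2 * pi))) \<longlonglongrightarrow>
      of_real (LINT y|lborel. h y * normal_density x \<sigma> y)"
    unfolding g_def using truncated_fourier_gaussian(2)[OF _ h2 \<sigma>, of _ x] by simp
qed

text \<open>Since \<open>h\<close> is only square integrable, its tail cannot be bounded by a
  supremum. Away from \<open>x\<close> the narrow density is instead dominated by \<open>c n\<close>
  times the fixed density \<open>N 0\<close>, against which \<open>h\<close> is integrable, and
  \<open>c n\<close> tends to 0.\<close>

lemma gaussian_approximate_identity:
  fixes h :: "real \<Rightarrow> real"
  assumes [measurable]: "h \<in> borel_measurable borel" and h2: "integrable lborel (\<lambda>y. (h y)\<^sup>2)"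
    and cont: "isCont h x"
  shows "(\<lambda>n. LINT y|lborel. h y * normal_density x (1 / real (Suc n)) y) \<longlonglongrightarrow> h x"
proof (rule LIMSEQ_I)
  fix e :: real assume e: "e > 0"
  define N where "N n y = normal_density x (1 / real (Suc n)) y" for n y
  have N_m [measurable]: "N n \<in> borel_measurable borel" for n unfolding N_def by measurable
  have N_int: "integrable lborel (N n)" "(LINT y|lborel. N n y) = 1" for n
    using integrable_normal_density[of "1 / real (Suc n)" x] integral_normal_density[of "1 / real (Suc n)" x]
    by (simp_all add: N_def[abs_def] del: of_nat_Suc)
  have N_nonneg: "N n y \<ge> 0" for n y by (simp add: N_def)
  have N_eq: "N n y = real (Suc n) * exp (- ((real (Suc n))\<^sup>2 * (y - x)\<^sup>2 / 2)) / sqrt (2 * pi)" for n y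
  proof -
    define m where "m = real (Suc n)"
    have m: "m > 0" by (simp add: m_def)
    have "1 / sqrt (2 * pi * (1 / m)\<^sup>2) = m / sqrt (2 * pi)"
      using m by (simp add: real_sqrt_mult)
    moreover have "- (y - x)\<^sup>2 / (2 * (1 / m)\<^sup>2) = - (m\<^sup>2 * (y - x)\<^sup>2 / 2)"
      using m by (simp add: power_divide)
    ultimately show ?thesis
      unfolding N_def normal_density_def m_def[symmetric] by simp
  qed
  have N_le: "N n y \<le> real (Suc n)" for n y
  proof -
    have "N n y \<le> real (Suc n) * 1 / sqrt (2 * pi)"
      unfolding N_eq by (intro divide_right_mono mult_left_mono) auto
    also have "\<dots> \<le> real (Suc n) / 1"
      using pi_ge_two by (subst mult_1_right, intro divide_left_mono) (auto intro!: real_le_rsqrt)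
    finally show ?thesis by simp
  qed
  have N2: "integrable lborel (\<lambda>y. (N n y)\<^sup>2)" for n
    by (rule Bochner_Integration.integrable_bound[OF integrable_mult_right[OF N_int(1)[of n], of "real (Suc n)"]])
       (use N_le N_nonneg in \<open>auto simp: power2_eq_square intro!: mult_right_mono\<close>)
  have hN: "integrable lborel (\<lambda>y. h y * N n y)" for n
    by (rule integrable_mult_L2) (use h2 N2 in auto)
  obtain \<delta> where \<delta>: "\<delta> > 0" "\<And>y. \<bar>y - x\<bar> < \<delta> \<Longrightarrow> \<bar>h y - h x\<bar> < e / 2"
    using cont e unfolding continuous_at_eps_delta dist_real_def by (metis half_gt_zero)
  \<comment> \<open>From \<open>exp (- a) <= 1 / (1 + a)\<close> with
    \<open>a = (m^2 - 1) * \<delta>^2 / 2\<close> and \<open>m = n + 1\<close>. The prefactor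
    \<open>m\<close> loses to the quadratic denominator.\<close>
  define c where "c n = real (Suc n) / (1 + ((real (Suc n))\<^sup>2 - 1) * (\<delta>\<^sup>2 / 2))" for n
  have tail: "N n y \<le> c n * N 0 y" if "\<bar>y - x\<bar> \<ge> \<delta>" for n y
  proof -
    define m where "m = real (Suc n)"
    have m: "m \<ge> 1" by (simp add: m_def)
    have N_m: "N n y = m * exp (- (m\<^sup>2 * (y - x)\<^sup>2 / 2)) / sqrt (2 * pi)"
      unfolding N_eq m_def ..
    have N_0: "N 0 y = exp (- ((y - x)\<^sup>2 / 2)) / sqrt (2 * pi)"
      by (simp add: N_eq)
    have d: "\<delta>\<^sup>2 \<le> (y - x)\<^sup>2" using that \<delta>(1) by (metis abs_le_square_iff abs_of_pos)
    have "m\<^sup>2 \<ge> 1" using m by (simp add: one_le_power)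
    then have a: "(m\<^sup>2 - 1) * (\<delta>\<^sup>2 / 2) \<ge> 0" "(m\<^sup>2 - 1) * (\<delta>\<^sup>2 / 2) \<le> (m\<^sup>2 - 1) * ((y - x)\<^sup>2 / 2)"
      using d by (auto intro!: mult_left_mono)
    have "- (m\<^sup>2 * (y - x)\<^sup>2 / 2) = - ((m\<^sup>2 - 1) * ((y - x)\<^sup>2 / 2)) + - ((y - x)\<^sup>2 / 2)"
      by (simp add: left_diff_distrib diff_divide_distrib)
    then have "exp (- (m\<^sup>2 * (y - x)\<^sup>2 / 2)) = exp (- ((m\<^sup>2 - 1) * ((y - x)\<^sup>2 / 2))) * exp (- ((y - x)\<^sup>2 / 2))"
      by (simp only: exp_add)
    also have "\<dots> \<le> exp (- ((m\<^sup>2 - 1) * (\<delta>\<^sup>2 / 2))) * exp (- ((y - x)\<^sup>2 / 2))"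
      using a by simp
    also have "exp (- ((m\<^sup>2 - 1) * (\<delta>\<^sup>2 / 2))) \<le> 1 / (1 + (m\<^sup>2 - 1) * (\<delta>\<^sup>2 / 2))"
      using exp_ge_add_one_self[of "(m\<^sup>2 - 1) * (\<delta>\<^sup>2 / 2)"] a(1) by (simp add: exp_minus divide_simps)
    finally have "exp (- (m\<^sup>2 * (y - x)\<^sup>2 / 2)) \<le> 1 / (1 + (m\<^sup>2 - 1) * (\<delta>\<^sup>2 / 2)) * exp (- ((y - x)\<^sup>2 / 2))"
      by simp
    then have "m * exp (- (m\<^sup>2 * (y - x)\<^sup>2 / 2)) / sqrt (2 * pi) \<le> m * (1 / (1 + (m\<^sup>2 - 1) * (\<delta>\<^sup>2 / 2)) * exp (- ((y - x)\<^sup>2 / 2))) / sqrt (2 * pi)"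
      using m by (intro divide_right_mono mult_left_mono) auto
    then show ?thesis unfolding N_m N_0 c_def m_def[symmetric] by simp
  qed
  have "c \<longlonglongrightarrow> 0"
    unfolding c_def using \<delta>(1) by real_asymp
  define K where "K = (LINT y|lborel. (\<bar>h y\<bar> + \<bar>h x\<bar>) * N 0 y)"
  have K_int: "integrable lborel (\<lambda>y. (\<bar>h y\<bar> + \<bar>h x\<bar>) * N 0 y)"
    using integrable_abs[OF hN[of 0]] N_int[of 0] N_nonneg[of 0] by (simp add: distrib_right abs_mult)
  have "K \<ge> 0" unfolding K_def using N_nonneg by (intro integral_nonneg_AE) auto
  from \<open>c \<longlonglongrightarrow> 0\<close> have "(\<lambda>n. c n * K) \<longlonglongrightarrow> 0" by (rule tendsto_mult_left_zero)
  from order_tendstoD(2)[OF this, of "e / 2"] e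
  obtain n0 where n0: "\<And>n. n \<ge> n0 \<Longrightarrow> c n * K < e / 2"
    by (auto simp: eventually_sequentially)
  have "\<bar>(LINT y|lborel. h y * N n y) - h x\<bar> < e" if "n \<ge> n0" for n
  proof -
    have c0: "c n \<ge> 0" unfolding c_def by (auto intro!: divide_nonneg_nonneg add_nonneg_nonneg mult_nonneg_nonneg)
    have "(LINT y|lborel. h y * N n y) - h x = (LINT y|lborel. (h y - h x) * N n y)"
      using hN N_int by (simp add: left_diff_distrib)
    also have "\<bar>\<dots>\<bar> \<le> (LINT y|lborel. e / 2 * N n y + c n * ((\<bar>h y\<bar> + \<bar>h x\<bar>) * N 0 y))"
    proof (rule integral_abs_bound_integral)
      fix y
      show "\<bar>(h y - h x) * N n y\<bar> \<le> e / 2 * N n y + c n * ((\<bar>h y\<bar> + \<bar>h x\<bar>) * N 0 y)"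
      proof (cases "\<bar>y - x\<bar> < \<delta>")
        case True
        then have "\<bar>h y - h x\<bar> * N n y \<le> e / 2 * N n y"
          using \<delta>(2)[OF True] N_nonneg by (intro mult_right_mono) auto
        then show ?thesis using N_nonneg[of 0 y] N_nonneg[of n y] c0 by (simp add: abs_mult add_increasing2)
      next
        case False
        have "\<bar>h y - h x\<bar> * N n y \<le> (\<bar>h y\<bar> + \<bar>h x\<bar>) * (c n * N 0 y)"
          using tail[of y n] False N_nonneg by (intro mult_mono) auto
        then show ?thesis using N_nonneg[of n y] e by (simp add: abs_mult add_increasing mult_ac)
      qed
    qed (use hN N_int K_int in \<open>auto simp: left_diff_distrib\<close>)
    also have "\<dots> = e / 2 + c n * K"
      using N_int K_int by (simp add: K_def)
    finally show ?thesis using n0[OF that] by linarith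
  qed
  then show "\<exists>n0. \<forall>n\<ge>n0. norm ((LINT y|lborel. h y * normal_density x (1 / real (Suc n)) y) - h x) < e"
    by (auto simp: N_def)
qed

text \<open>Let the width \<open>1 / (n + 1)\<close> tend to 0 in the Gaussian pairing: the space
  side is an approximate identity, and integrability of \<open>F\<close> allows the Gaussian weight
  to be removed by dominated convergence.\<close>

lemma fourier_inversion:
  assumes ft: "is_fourier_transform h F" and F: "integrable lborel F" and cont: "isCont h x"
  shows "of_real (h x) = (LINT \<xi>|lborel. F \<xi> * cis (x * \<xi>)) / of_real (sqrt (2 * pi))"
proof (rule LIMSEQ_unique)
  let ?s = "\<lambda>n. 1 / real (Suc n)"
  note [measurable] = is_fourier_transformD(2)[OF ft]
  show "(\<lambda>n. complex_of_real (LINT y|lborel. h y * normal_density x (?s n) y)) \<longlonglongrightarrow> of_real (h x)"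
    by (intro tendsto_of_real gaussian_approximate_identity is_fourier_transformD[OF ft] cont)
  have "(\<lambda>n. LINT \<xi>|lborel. F \<xi> * (cis (x * \<xi>) * of_real (exp (- (?s n * \<xi>)\<^sup>2 / 2)))) \<longlonglongrightarrow> (LINT \<xi>|lborel. F \<xi> * cis (x * \<xi>))"
  proof (rule integral_dominated_convergence[where w = "\<lambda>\<xi>. cmod (F \<xi>)"])
    show "AE \<xi> in lborel. (\<lambda>n. F \<xi> * (cis (x * \<xi>) * of_real (exp (- (?s n * \<xi>)\<^sup>2 / 2)))) \<longlonglongrightarrow> F \<xi> * cis (x * \<xi>)"
    proof (intro AE_I2)
      fix \<xi>
      have "?s \<longlonglongrightarrow> 0" by real_asymp
      then have "(\<lambda>n. exp (- (?s n * \<xi>)\<^sup>2 / 2)) \<longlonglongrightarrow> exp (- (0 * \<xi>)\<^sup>2 / 2)"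
        by (intro tendsto_intros) simp_all
      then have "(\<lambda>n. F \<xi> * (cis (x * \<xi>) * of_real (exp (- (?s n * \<xi>)\<^sup>2 / 2)))) \<longlonglongrightarrow> F \<xi> * (cis (x * \<xi>) * of_real (exp (- (0 * \<xi>)\<^sup>2 / 2)))"
        by (intro tendsto_mult tendsto_const tendsto_of_real)
      then show "(\<lambda>n. F \<xi> * (cis (x * \<xi>) * of_real (exp (- (?s n * \<xi>)\<^sup>2 / 2)))) \<longlonglongrightarrow> F \<xi> * cis (x * \<xi>)"
        by simp
    qed
  qed (use F in \<open>auto simp: norm_mult mult_left_le\<close>)
  then have "(\<lambda>n. (LINT \<xi>|lborel. F \<xi> * (cis (x * \<xi>) * of_real (exp (- (?s n * \<xi>)\<^sup>2 / 2)))) / of_real (sqrt (2 * pi)))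
      \<longlonglongrightarrow> (LINT \<xi>|lborel. F \<xi> * cis (x * \<xi>)) / of_real (sqrt (2 * pi))"
    by (intro tendsto_divide tendsto_const) auto
  then show "(\<lambda>n. complex_of_real (LINT y|lborel. h y * normal_density x (?s n) y))
      \<longlonglongrightarrow> (LINT \<xi>|lborel. F \<xi> * cis (x * \<xi>)) / of_real (sqrt (2 * pi))"
    by (subst (asm) fourier_gaussian_pairing[OF ft]) auto
qed

subsection \<open>The Sobolev embedding\<close>

text \<open>The weight is at most 1 on \<open>[-1, 1]\<close> and at most
  \<open>|\<xi>|^(-2 p)\<close> beyond, where \<open>2 p > 1\<close>. The left tail is the
  reflection of the right one.\<close>

lemma integrable_inverse_powr_weight:
  fixes p :: real
  assumes p: "p > 1/2"
  shows "integrable lborel (\<lambda>\<xi>. (1 + \<xi>\<^sup>2) powr - p)"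
proof (rule Bochner_Integration.integrable_bound)
  let ?t = "\<lambda>\<xi>::real. indicator {1..} \<xi> * \<xi> powr (- 2 * p)"
  have "((\<lambda>\<xi>. \<xi> powr (- 2 * p)) has_integral - (1 powr (- 2 * p + 1)) / (- 2 * p + 1)) {1..}"
    by (rule has_integral_powr_to_inf) (use p in auto)
  moreover have "?t = (\<lambda>\<xi>. if \<xi> \<in> {1..} then \<xi> powr (- 2 * p) else 0)"
    by (auto simp: indicator_def)
  ultimately have "(?t has_integral - (1 powr (- 2 * p + 1)) / (- 2 * p + 1)) UNIV"
    by (simp only: has_integral_restrict_UNIV)
  then have "(\<integral>\<^sup>+ \<xi>. ?t \<xi> \<partial>lborel) = ennreal (- (1 powr (- 2 * p + 1)) / (- 2 * p + 1))"
    by (intro nn_integral_has_integral_lborel) auto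
  then have t: "integrable lborel ?t"
    by (intro integrableI_nonneg) auto
  then have "integrable lborel (\<lambda>\<xi>. ?t (0 + (-1) * \<xi>))"
    by (intro lborel_integrable_real_affine) auto
  then show "integrable lborel (\<lambda>\<xi>. indicator {-1..1} \<xi> + ?t \<xi> + ?t (- \<xi>))"
    using t by (intro Bochner_Integration.integrable_add) (auto simp: emeasure_lborel_Icc_eq)
  show "AE \<xi> in lborel. norm ((1 + \<xi>\<^sup>2) powr - p) \<le> norm (indicator {-1..1} \<xi> + ?t \<xi> + ?t (- \<xi>))"
  proof (rule AE_I2)
    fix \<xi> :: real
    have le1: "(1 + \<xi>\<^sup>2) powr - p \<le> 1"
      using powr_mono2'[of "- p" 1 "1 + \<xi>\<^sup>2"] p by simp
    have le2: "(1 + \<xi>\<^sup>2) powr - p \<le> \<bar>\<xi>\<bar> powr (- 2 * p)" if "\<bar>\<xi>\<bar> \<ge> 1"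
    proof -
      have "(1 + \<xi>\<^sup>2) powr - p \<le> (\<bar>\<xi>\<bar> powr 2) powr - p"
        using that p by (intro powr_mono2') auto
      also have "\<dots> = \<bar>\<xi>\<bar> powr (- 2 * p)"
        by (simp only: powr_powr) simp
      finally show ?thesis .
    qed
    show "norm ((1 + \<xi>\<^sup>2) powr - p) \<le> norm (indicator {-1..1} \<xi> + ?t \<xi> + ?t (- \<xi>))"
      using le1 le2 by (auto simp: indicator_def abs_if split: if_splits)
  qed
qed measurable

text \<open>The mean value inequality bounds every difference quotient by \<open>B\<close>, so
  dominated convergence applies along any sequence approaching \<open>x\<close>.\<close>

lemma has_real_derivative_integral:
  fixes k k' :: "real \<Rightarrow> 'a \<Rightarrow> real"
  assumes int: "\<And>x. integrable M (k x)" and [measurable]: "\<And>x. k' x \<in> borel_measurable M"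
    and deriv: "\<And>x \<xi>. ((\<lambda>x. k x \<xi>) has_real_derivative k' x \<xi>) (at x)"
    and B: "integrable M B" "\<And>x \<xi>. \<bar>k' x \<xi>\<bar> \<le> B \<xi>"
  shows "((\<lambda>x. LINT \<xi>|M. k x \<xi>) has_real_derivative (LINT \<xi>|M. k' x \<xi>)) (at x)"
  unfolding has_field_derivative_iff tendsto_at_iff_sequentially comp_def
proof safe
  fix Y :: "nat \<Rightarrow> real" assume Y: "\<forall>i. Y i \<in> UNIV - {x}" "Y \<longlonglongrightarrow> x"
  note [measurable] = borel_measurable_integrable[OF int]
  have "(\<lambda>n. LINT \<xi>|M. (k (Y n) \<xi> - k x \<xi>) / (Y n - x)) \<longlonglongrightarrow> (LINT \<xi>|M. k' x \<xi>)"
  proof (rule integral_dominated_convergence[where w = B])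
    show "AE \<xi> in M. (\<lambda>n. (k (Y n) \<xi> - k x \<xi>) / (Y n - x)) \<longlonglongrightarrow> k' x \<xi>"
      using deriv[of _ x] Y unfolding has_field_derivative_iff tendsto_at_iff_sequentially comp_def by blast
    show "AE \<xi> in M. norm ((k (Y n) \<xi> - k x \<xi>) / (Y n - x)) \<le> B \<xi>" for n
    proof (rule AE_I2)
      fix \<xi>
      have "norm (k (Y n) \<xi> - k x \<xi>) \<le> B \<xi> * norm (Y n - x)"
        using B(2) deriv
        by (intro field_differentiable_bound[of UNIV]) (auto intro: has_field_derivative_at_within)
      moreover have "\<bar>Y n - x\<bar> > 0" using Y by auto
      ultimately show "norm ((k (Y n) \<xi> - k x \<xi>) / (Y n - x)) \<le> B \<xi>"
        by (simp add: abs_divide pos_divide_le_eq)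
    qed
  qed (use B(1) in auto)
  then show "(\<lambda>n. ((LINT \<xi>|M. k (Y n) \<xi>) - (LINT \<xi>|M. k x \<xi>)) / (Y n - x)) \<longlonglongrightarrow> (LINT \<xi>|M. k' x \<xi>)"
    using int by simp
qed

text \<open>Membership in \<open>sobolev s\<close> provides some transform with finite weighted
  integral; uniqueness almost everywhere carries this over to the one picked by
  \<open>SOME\<close>.\<close>

lemma fourier_transform_sobolev:
  assumes "h \<in> sobolev s"
  shows "is_fourier_transform h (fourier_transform h)"
    and "integrable lborel (\<lambda>\<xi>. (1 + \<xi>\<^sup>2) powr s * (cmod (fourier_transform h \<xi>))\<^sup>2)"
proof -
  obtain F where F: "is_fourier_transform h F" "integrable lborel (\<lambda>\<xi>. (1 + \<xi>\<^sup>2) powr s * (cmod (F \<xi>))\<^sup>2)"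
    using assms by (auto simp: sobolev_def)
  show ft: "is_fourier_transform h (fourier_transform h)"
    unfolding fourier_transform_def using someI[of "is_fourier_transform h", OF F(1)] .
  note [measurable] = is_fourier_transformD(2)[OF ft] is_fourier_transformD(2)[OF F(1)]
  show "integrable lborel (\<lambda>\<xi>. (1 + \<xi>\<^sup>2) powr s * (cmod (fourier_transform h \<xi>))\<^sup>2)"
    by (rule integrable_cong_AE_imp[OF F(2)]) (use is_fourier_transform_unique[OF ft F(1)] in auto)
qed

text \<open>Cauchy-Schwarz bounds the integral of \<open>(1 + |\<xi>|) |F|\<close> by the Sobolev
  norm. That one integral dominates both the inversion formula and its formal derivative, which
  gives differentiability and both bounds. The constant depends on \<open>s\<close> only, so it
  serves all times at once.\<close>

lemma sobolev_embedding:
  assumes s: "s > 3/2"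
  obtains C where "C \<ge> 0" and "\<And>h x. h \<in> sobolev s \<Longrightarrow> continuous_on UNIV h \<Longrightarrow> h field_differentiable at x"
    and "\<And>h x. h \<in> sobolev s \<Longrightarrow> continuous_on UNIV h \<Longrightarrow> \<bar>h x\<bar> \<le> C * sobolev_norm s h"
    and "\<And>h x. h \<in> sobolev s \<Longrightarrow> continuous_on UNIV h \<Longrightarrow> \<bar>deriv h x\<bar> \<le> C * sobolev_norm s h"
proof
  \<comment> \<open>The quotient of the weight wanted by the weight in the norm. Its square decays
    like \<open>(1 + \<xi>^2)^(1 - s)\<close>, which is integrable because
    \<open>s - 1 > 1/2\<close>.\<close>
  define m where "m \<xi> = (1 + \<bar>\<xi>\<bar>) * (1 + \<xi>\<^sup>2) powr (- s / 2)" for \<xi> :: real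
  have [measurable]: "m \<in> borel_measurable borel" unfolding m_def by measurable
  have m2: "integrable lborel (\<lambda>\<xi>. (m \<xi>)\<^sup>2)"
  proof (rule Bochner_Integration.integrable_bound)
    show "integrable lborel (\<lambda>\<xi>. 2 * (1 + \<xi>\<^sup>2) powr - (s - 1))"
      using s by (intro integrable_mult_right integrable_inverse_powr_weight) auto
    show "AE \<xi> in lborel. norm ((m \<xi>)\<^sup>2) \<le> norm (2 * (1 + \<xi>\<^sup>2) powr - (s - 1))"
    proof (rule AE_I2)
      fix \<xi> :: real
      have pos: "1 + \<xi>\<^sup>2 > 0" by (simp add: add_pos_nonneg)
      have "(1 + \<bar>\<xi>\<bar>)\<^sup>2 \<le> 2 * (1 + \<xi>\<^sup>2)"
        using sum_squares_bound[of 1 "\<bar>\<xi>\<bar>"] by (simp add: power2_sum)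
      moreover have "(m \<xi>)\<^sup>2 = (1 + \<bar>\<xi>\<bar>)\<^sup>2 * (1 + \<xi>\<^sup>2) powr (- s)"
      proof -
        have "((1 + \<xi>\<^sup>2) powr (- s / 2))\<^sup>2 = (1 + \<xi>\<^sup>2) powr (- s)"
          by (simp add: power2_eq_square flip: powr_add)
        then show ?thesis by (simp only: m_def power_mult_distrib)
      qed
      ultimately have "(m \<xi>)\<^sup>2 \<le> 2 * (1 + \<xi>\<^sup>2) * (1 + \<xi>\<^sup>2) powr (- s)"
        by (simp add: mult_right_mono)
      also have "2 * (1 + \<xi>\<^sup>2) * (1 + \<xi>\<^sup>2) powr (- s) = 2 * ((1 + \<xi>\<^sup>2) powr 1 * (1 + \<xi>\<^sup>2) powr (- s))"
        using pos by simp
      also have "(1 + \<xi>\<^sup>2) powr 1 * (1 + \<xi>\<^sup>2) powr (- s) = (1 + \<xi>\<^sup>2) powr - (s - 1)"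
        using powr_add[of "1 + \<xi>\<^sup>2" 1 "-s"] by simp
      finally show "norm ((m \<xi>)\<^sup>2) \<le> norm (2 * (1 + \<xi>\<^sup>2) powr - (s - 1))"
        by simp
    qed
  qed measurable
  define C where "C = sqrt (LINT \<xi>|lborel. (m \<xi>)\<^sup>2)"
  show "C \<ge> 0" by (simp add: C_def)
  fix h x assume h: "h \<in> sobolev s" and cont: "continuous_on UNIV h"
  define F where "F = fourier_transform h"
  have ft: "is_fourier_transform h F" and
    F2: "integrable lborel (\<lambda>\<xi>. ((1 + \<xi>\<^sup>2) powr (s / 2) * cmod (F \<xi>))\<^sup>2)" and
    norm_h: "sobolev_norm s h = sqrt (LINT \<xi>|lborel. ((1 + \<xi>\<^sup>2) powr (s / 2) * cmod (F \<xi>))\<^sup>2)"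
  proof -
    have "((1 + \<xi>\<^sup>2) powr (s / 2))\<^sup>2 = (1 + \<xi>\<^sup>2) powr s" for \<xi> :: real
      by (simp add: power2_eq_square flip: powr_add)
    then show "is_fourier_transform h F" "integrable lborel (\<lambda>\<xi>. ((1 + \<xi>\<^sup>2) powr (s / 2) * cmod (F \<xi>))\<^sup>2)"
      "sobolev_norm s h = sqrt (LINT \<xi>|lborel. ((1 + \<xi>\<^sup>2) powr (s / 2) * cmod (F \<xi>))\<^sup>2)"
      using fourier_transform_sobolev[OF h] by (simp_all add: F_def sobolev_norm_def power_mult_distrib)
  qed
  note [measurable] = is_fourier_transformD(2)[OF ft]
  have m_eq: "m \<xi> * ((1 + \<xi>\<^sup>2) powr (s / 2) * cmod (F \<xi>)) = (1 + \<bar>\<xi>\<bar>) * cmod (F \<xi>)" for \<xi>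
  proof -
    have "(1 + \<xi>\<^sup>2) powr (- s / 2) * (1 + \<xi>\<^sup>2) powr (s / 2) = 1"
      by (simp add: add_nonneg_eq_0_iff flip: powr_add)
    then show ?thesis by (simp add: m_def mult.assoc)
  qed
  have B: "integrable lborel (\<lambda>\<xi>. (1 + \<bar>\<xi>\<bar>) * cmod (F \<xi>))"
    using integrable_mult_L2[OF _ _ m2 F2] by (simp add: m_eq)
  have B_le: "(LINT \<xi>|lborel. (1 + \<bar>\<xi>\<bar>) * cmod (F \<xi>)) \<le> C * sobolev_norm s h"
    using Cauchy_Schwarz_L2[OF _ _ m2 F2] by (simp add: m_eq norm_h C_def abs_mult)
  have F_int: "integrable lborel F"
    by (rule Bochner_Integration.integrable_bound[OF B]) (auto simp: mult_le_cancel_right1 abs_mult)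
  have F_cis: "integrable lborel (\<lambda>\<xi>. F \<xi> * cis (x * \<xi>))" for x
    by (rule Bochner_Integration.integrable_bound[OF F_int]) (auto simp: norm_mult)
  have h_eq: "h = (\<lambda>x. (LINT \<xi>|lborel. Re (F \<xi> * cis (x * \<xi>))) / sqrt (2 * pi))"
  proof
    fix x
    have "of_real (h x) = (LINT \<xi>|lborel. F \<xi> * cis (x * \<xi>)) / of_real (sqrt (2 * pi))"
      using ft F_int cont by (intro fourier_inversion) (auto simp: continuous_on_eq_continuous_at)
    then have "h x = Re ((LINT \<xi>|lborel. F \<xi> * cis (x * \<xi>)) / of_real (sqrt (2 * pi)))"
      by (metis Re_complex_of_real)
    then show "h x = (LINT \<xi>|lborel. Re (F \<xi> * cis (x * \<xi>))) / sqrt (2 * pi)"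
      by (simp only: Re_divide_of_real integral_Re[OF F_cis])
  qed
  have deriv: "(h has_real_derivative (LINT \<xi>|lborel. - \<xi> * Im (F \<xi> * cis (x * \<xi>))) / sqrt (2 * pi)) (at x)" for x
    unfolding h_eq
  proof (intro DERIV_cdivide has_real_derivative_integral)
    show "integrable lborel (\<lambda>\<xi>. (1 + \<bar>\<xi>\<bar>) * cmod (F \<xi>))" by (rule B)
    show "\<bar>- \<xi> * Im (F \<xi> * cis (x * \<xi>))\<bar> \<le> (1 + \<bar>\<xi>\<bar>) * cmod (F \<xi>)" for x \<xi>
      using abs_Im_le_cmod[of "F \<xi> * cis (x * \<xi>)"] unfolding abs_mult
      by (intro mult_mono) (auto simp: norm_mult)
    show "((\<lambda>x. Re (F \<xi> * cis (x * \<xi>))) has_real_derivative - \<xi> * Im (F \<xi> * cis (x * \<xi>))) (at x)" for x \<xi>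
      by (auto intro!: derivative_eq_intros simp: algebra_simps)
    show "(\<lambda>\<xi>. - \<xi> * Im (F \<xi> * cis (x * \<xi>))) \<in> borel_measurable lborel" for x
      by measurable
    show "integrable lborel (\<lambda>\<xi>. Re (F \<xi> * cis (x * \<xi>)))" for x
      using F_cis by (rule integrable_Re)
  qed
  then show "h field_differentiable at x"
    by (auto simp: field_differentiable_def)
  \<comment> \<open>The normalising factor is at most 1 and is dropped from the bounds.\<close>
  have sqrt: "\<bar>a / sqrt (2 * pi)\<bar> \<le> b" if "\<bar>a\<bar> \<le> b" for a b :: real
  proof -
    have "1 \<le> sqrt (2 * pi)" using pi_ge_two by (auto intro!: real_le_rsqrt)
    then have "\<bar>a\<bar> / sqrt (2 * pi) \<le> \<bar>a\<bar> / 1" by (intro divide_left_mono) auto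
    then show ?thesis using that by simp
  qed
  have le: "\<bar>(LINT \<xi>|lborel. k \<xi>) / sqrt (2 * pi)\<bar> \<le> C * sobolev_norm s h"
    if "\<And>\<xi>. \<bar>k \<xi>\<bar> \<le> (1 + \<bar>\<xi>\<bar>) * cmod (F \<xi>)" and [measurable]: "k \<in> borel_measurable borel" for k :: "real \<Rightarrow> real"
  proof (rule sqrt)
    have "integrable lborel k"
      by (rule Bochner_Integration.integrable_bound[OF B]) (use that in \<open>auto intro: order_trans[OF _ abs_ge_self]\<close>)
    then have "\<bar>LINT \<xi>|lborel. k \<xi>\<bar> \<le> (LINT \<xi>|lborel. (1 + \<bar>\<xi>\<bar>) * cmod (F \<xi>))"
      by (intro integral_abs_bound_integral B that)
    then show "\<bar>LINT \<xi>|lborel. k \<xi>\<bar> \<le> C * sobolev_norm s h" using B_le by simp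
  qed
  show "\<bar>h x\<bar> \<le> C * sobolev_norm s h"
    unfolding fun_cong[OF h_eq, of x]
  proof (rule le)
    show "\<bar>Re (F \<xi> * cis (x * \<xi>))\<bar> \<le> (1 + \<bar>\<xi>\<bar>) * cmod (F \<xi>)" for \<xi>
      using abs_Re_le_cmod[of "F \<xi> * cis (x * \<xi>)"] by (simp add: norm_mult distrib_right add_increasing2)
  qed measurable
  show "\<bar>deriv h x\<bar> \<le> C * sobolev_norm s h"
    unfolding DERIV_imp_deriv[OF deriv]
  proof (rule le)
    show "\<bar>- \<xi> * Im (F \<xi> * cis (x * \<xi>))\<bar> \<le> (1 + \<bar>\<xi>\<bar>) * cmod (F \<xi>)" for \<xi>
      using abs_Im_le_cmod[of "F \<xi> * cis (x * \<xi>)"] unfolding abs_mult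
      by (intro mult_mono) (auto simp: norm_mult)
  qed measurable
qed

subsection \<open>The convolution kernel\<close>

text \<open>The function is dominated by two exponential densities placed back to back at
  \<open>x\<close>, each of mass 1.\<close>

lemma
  fixes x :: real
  shows integrable_exp_abs: "integrable lborel (\<lambda>y. exp (- \<bar>x - y\<bar>))"
    and integral_exp_abs_le: "(LINT y|lborel. exp (- \<bar>x - y\<bar>)) \<le> 2"
proof -
  let ?e = "exponential_density 1"
  have e: "has_bochner_integral lborel ?e 1"
  proof -
    have "nn_integral lborel ?e = 1"
      using prob_space.emeasure_space_1[OF prob_space_exponential_density[of 1]] by (simp add: emeasure_density)
    then show ?thesis
      by (intro has_bochner_integral_nn_integral) (auto simp: exponential_density_def)
  qed
  have e1: "has_bochner_integral lborel (\<lambda>y. ?e (x - y)) 1"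
    using lborel_has_bochner_integral_real_affine_iff[of "-1" ?e 1 x] e by simp
  have e2: "has_bochner_integral lborel (\<lambda>y. ?e (y - x)) 1"
    using lborel_has_bochner_integral_real_affine_iff[of "1" ?e 1 "-x"] e by simp
  have s: "has_bochner_integral lborel (\<lambda>y. ?e (x - y) + ?e (y - x)) (1 + 1)"
    by (rule has_bochner_integral_add[OF e1 e2])
  have le: "exp (- \<bar>x - y\<bar>) \<le> ?e (x - y) + ?e (y - x)" for y
    by (auto simp: exponential_density_def abs_if)
  show int: "integrable lborel (\<lambda>y. exp (- \<bar>x - y\<bar>))"
    by (rule Bochner_Integration.integrable_bound[OF integrable.intros[OF s]])
       (use le in \<open>auto intro: order_trans[OF _ abs_ge_self]\<close>)
  show "(LINT y|lborel. exp (- \<bar>x - y\<bar>)) \<le> 2"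
    using integral_mono[OF int integrable.intros[OF s] le] has_bochner_integral_integral_eq[OF s] by simp
qed

definition dx_kernel :: "real \<Rightarrow> real" where
  "dx_kernel x = - sgn x * helmholtz_kernel x"

lemma dx_kernel_measurable [measurable]: "dx_kernel \<in> borel_measurable borel"
  unfolding dx_kernel_def helmholtz_kernel_def by measurable

lemma dx_inv_helmholtz_eq: "dx_inv_helmholtz h x = (LINT y|lborel. dx_kernel (x - y) * h y)"
  by (simp add: dx_inv_helmholtz_def Defs.convolution_def dx_kernel_def)

text \<open>The jump matters only for \<open>y\<close> between \<open>x\<close> and
  \<open>x'\<close>, where two values of size at most 1/2 differ by at most 1. Elsewhere the signs
  agree and only exponentials are compared; keeping them on the right makes the bound integrable in
  \<open>y\<close>.\<close>

lemma dx_kernel_lipschitz_off_diagonal: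
  fixes x x' y :: real
  shows "\<bar>dx_kernel (x - y) - dx_kernel (x' - y)\<bar>
    \<le> \<bar>x - x'\<bar> / 2 * (exp (- \<bar>x - y\<bar>) + exp (- \<bar>x' - y\<bar>)) + indicator {min x x'..max x x'} y"
proof -
  have diff: "\<bar>exp (- a) - exp (- b)\<bar> \<le> \<bar>a - b\<bar> * (exp (- a) + exp (- b))" for a b :: real
  proof (induction a b rule: linorder_wlog)
    case (le a b)
    have "1 - (b - a) \<le> exp (- (b - a))" using exp_ge_add_one_self[of "- (b - a)"] by linarith
    then have "exp (- a) * (1 - (b - a)) \<le> exp (- a) * exp (- (b - a))" by (intro mult_left_mono) auto
    also have "\<dots> = exp (- b)" by (simp flip: exp_add)
    finally have "exp (- a) - exp (- b) \<le> (b - a) * exp (- a)" by (simp add: algebra_simps)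
    moreover have "0 \<le> (b - a) * exp (- b)" "exp (- b) \<le> exp (- a)" using le by auto
    moreover have "\<bar>a - b\<bar> * (exp (- a) + exp (- b)) = (b - a) * exp (- a) + (b - a) * exp (- b)"
      using le by (simp add: distrib_left)
    ultimately show ?case by linarith
  next
    case (sym a b)
    then show ?case by (simp add: abs_minus_commute add.commute)
  qed
  show ?thesis
  proof (cases "y \<in> {min x x'..max x x'}")
    case True
    have "\<bar>dx_kernel z\<bar> \<le> 1 / 2" for z
      by (auto simp: dx_kernel_def helmholtz_kernel_def abs_mult sgn_if)
    from this[of "x - y"] this[of "x' - y"] have "\<bar>dx_kernel (x - y) - dx_kernel (x' - y)\<bar> \<le> 1"
      by linarith
    moreover have "0 \<le> \<bar>x - x'\<bar> / 2 * (exp (- \<bar>x - y\<bar>) + exp (- \<bar>x' - y\<bar>))" by simp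
    moreover have "indicator {min x x'..max x x'} y = (1 :: real)" using True by simp
    ultimately show ?thesis by linarith
  next
    case False
    then have sgn: "sgn (x - y) = sgn (x' - y)" "\<bar>sgn (x' - y)\<bar> = 1" by (auto simp: min_def max_def sgn_if split: if_splits)
    have "\<bar>dx_kernel (x - y) - dx_kernel (x' - y)\<bar> = \<bar>- sgn (x' - y) * ((exp (- \<bar>x - y\<bar>) - exp (- \<bar>x' - y\<bar>)) / 2)\<bar>"
      unfolding sgn dx_kernel_def helmholtz_kernel_def by (simp add: right_diff_distrib diff_divide_distrib)
    also have "\<dots> = \<bar>exp (- \<bar>x - y\<bar>) - exp (- \<bar>x' - y\<bar>)\<bar> / 2"
      using sgn(2) by (simp add: abs_mult)
    also have "\<dots> \<le> \<bar>\<bar>x - y\<bar> - \<bar>x' - y\<bar>\<bar> * (exp (- \<bar>x - y\<bar>) + exp (- \<bar>x' - y\<bar>)) / 2"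
      using diff by (intro divide_right_mono) auto
    also have "\<dots> \<le> \<bar>x - x'\<bar> * (exp (- \<bar>x - y\<bar>) + exp (- \<bar>x' - y\<bar>)) / 2"
      by (intro divide_right_mono mult_right_mono add_nonneg_nonneg) auto
    finally show ?thesis using False by simp
  qed
qed

context
  fixes h :: "real \<Rightarrow> real" and H :: real
  assumes h_measurable [measurable]: "h \<in> borel_measurable borel" and h_bound: "\<And>y. \<bar>h y\<bar> \<le> H"
begin

lemma dx_kernel_mult_bound: "\<bar>dx_kernel (x - y) * h y\<bar> \<le> H / 2 * exp (- \<bar>x - y\<bar>)"
proof -
  have "\<bar>dx_kernel (x - y)\<bar> * \<bar>h y\<bar> \<le> exp (- \<bar>x - y\<bar>) / 2 * H"
    using h_bound by (intro mult_mono) (auto simp: dx_kernel_def helmholtz_kernel_def abs_mult sgn_if)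
  then show ?thesis by (simp only: abs_mult) (simp add: mult.commute)
qed

lemma integrable_dx_inv_helmholtz: "integrable lborel (\<lambda>y. dx_kernel (x - y) * h y)"
  by (rule Bochner_Integration.integrable_bound[OF integrable_mult_right[OF integrable_exp_abs[of x], of "H / 2"]])
     (use dx_kernel_mult_bound in \<open>auto intro: order_trans[OF _ abs_ge_self]\<close>)

lemma bound_nonneg: "H \<ge> 0"
  using h_bound[of 0] by linarith

lemma dx_inv_helmholtz_bound: "\<bar>dx_inv_helmholtz h x\<bar> \<le> H"
proof -
  have "\<bar>dx_inv_helmholtz h x\<bar> \<le> (LINT y|lborel. H / 2 * exp (- \<bar>x - y\<bar>))"
    unfolding dx_inv_helmholtz_eq
    by (intro integral_abs_bound_integral integrable_dx_inv_helmholtz dx_kernel_mult_bound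
        integrable_mult_right integrable_exp_abs)
  also have "\<dots> \<le> H / 2 * 2"
    unfolding integral_mult_right_zero by (intro mult_left_mono integral_exp_abs_le) (use bound_nonneg in auto)
  finally show ?thesis by simp
qed

text \<open>This is the gain of one derivative: a bound on \<open>h\<close> controls the slope of
  the convolution. In the constant 3, the exponential part contributes 2 and the jump of the kernel
  1.\<close>

lemma dx_inv_helmholtz_lipschitz: "\<bar>dx_inv_helmholtz h x - dx_inv_helmholtz h x'\<bar> \<le> 3 * H * \<bar>x - x'\<bar>"
proof -
  let ?B = "\<lambda>y. H * (\<bar>x - x'\<bar> / 2 * (exp (- \<bar>x - y\<bar>) + exp (- \<bar>x' - y\<bar>)) + indicator {min x x'..max x x'} y)"
  have I: "integrable lborel (indicator {min x x'..max x x'} :: real \<Rightarrow> real)"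
    by (auto simp: emeasure_lborel_Icc_eq)
  have I_eq: "(LINT y|lborel. indicator {min x x'..max x x'} y) = \<bar>x - x'\<bar>"
    by auto
  have B: "integrable lborel ?B"
    by (intro integrable_mult_right Bochner_Integration.integrable_add integrable_exp_abs I)
  have "\<bar>dx_inv_helmholtz h x - dx_inv_helmholtz h x'\<bar> = \<bar>LINT y|lborel. dx_kernel (x - y) * h y - dx_kernel (x' - y) * h y\<bar>"
    unfolding dx_inv_helmholtz_eq
    by (subst Bochner_Integration.integral_diff[OF integrable_dx_inv_helmholtz integrable_dx_inv_helmholtz]) simp
  also have "\<dots> \<le> (LINT y|lborel. ?B y)"
  proof (rule integral_abs_bound_integral)
    show "\<bar>dx_kernel (x - y) * h y - dx_kernel (x' - y) * h y\<bar> \<le> ?B y" for y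
    proof -
      have "\<bar>dx_kernel (x - y) * h y - dx_kernel (x' - y) * h y\<bar> = \<bar>(dx_kernel (x - y) - dx_kernel (x' - y)) * h y\<bar>"
        by (simp only: left_diff_distrib)
      also have "\<dots> = \<bar>h y\<bar> * \<bar>dx_kernel (x - y) - dx_kernel (x' - y)\<bar>"
        by (simp only: abs_mult mult.commute)
      also have "\<dots> \<le> ?B y"
        by (intro mult_mono h_bound dx_kernel_lipschitz_off_diagonal bound_nonneg) auto
      finally show ?thesis .
    qed
  qed (intro Bochner_Integration.integrable_diff integrable_dx_inv_helmholtz B)+
  also have "\<dots> = H * (\<bar>x - x'\<bar> / 2 * ((LINT y|lborel. exp (- \<bar>x - y\<bar>)) + (LINT y|lborel. exp (- \<bar>x' - y\<bar>))) + \<bar>x - x'\<bar>)"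
    using integrable_exp_abs[of x] integrable_exp_abs[of x'] I I_eq by simp
  also have "\<dots> \<le> H * (\<bar>x - x'\<bar> / 2 * (2 + 2) + \<bar>x - x'\<bar>)"
    by (intro mult_left_mono add_mono integral_exp_abs_le bound_nonneg order_refl) auto
  finally show ?thesis by (simp add: algebra_simps)
qed

text \<open>Passing from \<open>a\<close> to \<open>b\<close> strictly increases the kernel \<open>y \<mapsto> dx_kernel (\<cdot> - y)\<close> at every \<open>y\<close>
  outside \<open>[a, b]\<close>.\<close>

lemma dx_inv_helmholtz_eq_imp_zero:
  assumes nonneg: "\<And>y. h y \<ge> 0" and ab: "a < b" and zero: "\<And>y. y \<in> {a..b} \<Longrightarrow> h y = 0"
    and eq: "dx_inv_helmholtz h a = dx_inv_helmholtz h b"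
  shows "AE y in lborel. h y = 0"
proof -
  have pos: "dx_kernel (b - y) - dx_kernel (a - y) > 0" if "y \<notin> {a..b}" for y
    using that ab by (auto simp: dx_kernel_def helmholtz_kernel_def sgn_if)
  have "(LINT y|lborel. dx_kernel (b - y) * h y - dx_kernel (a - y) * h y) = 0"
    by (subst Bochner_Integration.integral_diff[OF integrable_dx_inv_helmholtz integrable_dx_inv_helmholtz])
       (use eq in \<open>simp add: dx_inv_helmholtz_eq\<close>)
  moreover have "dx_kernel (b - y) * h y - dx_kernel (a - y) * h y \<ge> 0" for y
  proof (cases "y \<in> {a..b}")
    case False
    then show ?thesis
      using mult_nonneg_nonneg[OF less_imp_le[OF pos[OF False]] nonneg] by (simp only: left_diff_distrib)
  qed (simp add: zero)
  ultimately have "AE y in lborel. dx_kernel (b - y) * h y - dx_kernel (a - y) * h y = 0"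
    by (subst (asm) integral_nonneg_eq_0_iff_AE)
       (auto intro!: Bochner_Integration.integrable_diff integrable_dx_inv_helmholtz)
  then show ?thesis
  proof eventually_elim
    case (elim y)
    then show ?case
      using pos[of y] zero[of y] by (cases "y \<in> {a..b}") (simp_all only: left_diff_distrib[symmetric] mult_eq_0_iff, auto)
  qed
qed

end

subsection \<open>Transport equations\<close>

text \<open>Two space variables let one principle serve both estimates below: the sup bound leaves
  the second variable idle, while the Lipschitz bound compares \<open>v\<close> at two
  points.\<close>

lemma transport_maximum_principle:
  fixes w wt wx wy c1 c2 :: "real \<Rightarrow> real \<Rightarrow> real \<Rightarrow> real"
  assumes cont: "continuous_on ({0..\<tau>} \<times> UNIV) (\<lambda>(t, x, y). w t x y)"
    and bdd: "\<And>t x y. t \<in> {0..\<tau>} \<Longrightarrow> w t x y \<le> M"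
    and init: "\<And>x y. w 0 x y \<le> 0"
    and wt: "\<And>t x y. t \<in> {0<..\<tau>} \<Longrightarrow> ((\<lambda>t. w t x y) has_real_derivative wt t x y) (at t)"
    and wx: "\<And>t x y. t \<in> {0<..\<tau>} \<Longrightarrow> ((\<lambda>x. w t x y) has_real_derivative wx t x y) (at x)"
    and wy: "\<And>t x y. t \<in> {0<..\<tau>} \<Longrightarrow> ((\<lambda>y. w t x y) has_real_derivative wy t x y) (at y)"
    and c: "\<And>t x y. t \<in> {0<..\<tau>} \<Longrightarrow> \<bar>c1 t x y\<bar> \<le> C" "\<And>t x y. t \<in> {0<..\<tau>} \<Longrightarrow> \<bar>c2 t x y\<bar> \<le> C"
    and ineq: "\<And>t x y. t \<in> {0<..\<tau>} \<Longrightarrow> wt t x y + c1 t x y * wx t x y + c2 t x y * wy t x y \<le> 0"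
    and t: "t \<in> {0..\<tau>}"
  shows "w t x y \<le> 0"
proof (rule ccontr)
  txt \<open>Subtracting the growing penalty \<open>\<epsilon> P\<close> makes a positive supremum attained. At the maximum the space
    derivatives of \<open>w\<close> are those of the penalty, whose time derivative dominates the transport terms.\<close>
  assume "\<not> w t x y \<le> 0"
  then have pos: "w t x y > 0" by simp
  \<comment> \<open>A differentiable substitute for \<open>|z|\<close>: its growth confines the
    maximum to a box, and its slope of at most 1 limits each transport term to \<open>C\<close>
    times the penalty factor.\<close>
  define \<psi> where "\<psi> z = sqrt (1 + z\<^sup>2)" for z :: real
  have \<psi>_ge: "\<psi> z \<ge> 1" "\<psi> z \<ge> \<bar>z\<bar>" for z
    by (auto simp: \<psi>_def intro!: real_le_rsqrt)
  have \<psi>_deriv: "(\<psi> has_real_derivative z / \<psi> z) (at z)" for z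
  proof -
    have "1 + z\<^sup>2 > 0" by (simp add: add_pos_nonneg)
    then show ?thesis
      unfolding \<psi>_def by (auto intro!: derivative_eq_intros simp: field_simps)
  qed
  have \<psi>_deriv_le: "\<bar>z / \<psi> z\<bar> \<le> 1" for z
    using \<psi>_ge[of z] by (simp add: abs_divide)
  \<comment> \<open>As \<open>\<psi> x + \<psi> y >= 2\<close>, the penalty grows in time at rate at
    least \<open>2 * C + 2\<close>, strictly more than the \<open>2 * C\<close> that the two
    transport terms can supply.\<close>
  define A where "A = C + 1"
  define P where "P t x y = exp (A * t) * (\<psi> x + \<psi> y)" for t x y
  have P_pos: "P t x y > 0" for t x y
    using \<psi>_ge(1)[of x] \<psi>_ge(1)[of y] by (simp add: P_def)
  \<comment> \<open>With this choice the penalty removes exactly half of the offending positive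
    value.\<close>
  define \<epsilon> where "\<epsilon> = w t x y / (2 * P t x y)"
  have \<epsilon>: "\<epsilon> > 0" using pos P_pos by (simp add: \<epsilon>_def)
  define \<Phi> where "\<Phi> t x y = w t x y - \<epsilon> * P t x y" for t x y
  have \<Phi>_pos: "\<Phi> t x y > 0"
    using pos P_pos[of t x y] by (simp add: \<Phi>_def \<epsilon>_def)
  have C0: "C \<ge> 0" if "\<tau> > 0" using c(1)[of \<tau>] that by force
  \<comment> \<open>Beyond distance \<open>R\<close> in either variable the penalty alone exceeds
    the upper bound \<open>M\<close> of \<open>w\<close>.\<close>
  define R where "R = M / \<epsilon>"
  have \<Phi>_out: "\<Phi> s a b \<le> 0" if "s \<in> {0..\<tau>}" "\<bar>a\<bar> > R \<or> \<bar>b\<bar> > R" for s a b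
  proof (cases "s = 0")
    case True
    then show ?thesis using init[of a b] P_pos[of s a b] \<epsilon> by (simp add: \<Phi>_def) (smt (verit) mult_pos_pos)
  next
    case False
    then have "C \<ge> 0" using that C0 by simp
    then have "1 * (\<psi> a + \<psi> b) \<le> P s a b"
      unfolding P_def using that(1) \<psi>_ge(1)[of a] \<psi>_ge(1)[of b]
      by (intro mult_right_mono) (auto simp: A_def)
    moreover have "\<psi> a + \<psi> b \<ge> R" using that(2) \<psi>_ge[of a] \<psi>_ge[of b] by linarith
    ultimately have "\<epsilon> * R \<le> \<epsilon> * P s a b" using \<epsilon> by simp
    then have "M \<le> \<epsilon> * P s a b" using \<epsilon> by (simp add: R_def)
    then show ?thesis using bdd[OF that(1), of a b] by (simp add: \<Phi>_def)
  qed
  define S where "S = {0..\<tau>} \<times> {-R..R} \<times> {-R..R}"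
  have "compact S" unfolding S_def by (intro compact_Times compact_Icc)
  moreover have "S \<noteq> {}"
  proof -
    have "\<bar>x\<bar> \<le> R \<and> \<bar>y\<bar> \<le> R" using \<Phi>_out[OF t, of x y] \<Phi>_pos by (meson not_less)
    then have "(t, x, y) \<in> S" using t by (auto simp: S_def abs_le_iff)
    then show ?thesis by auto
  qed
  moreover have "continuous_on S (\<lambda>(t, x, y). \<Phi> t x y)"
  proof -
    have "continuous_on S (\<lambda>(t, x, y). w t x y)"
      by (rule continuous_on_subset[OF cont]) (auto simp: S_def)
    moreover have "continuous_on S (\<lambda>p. P (fst p) (fst (snd p)) (snd (snd p)))"
      unfolding P_def \<psi>_def by (intro continuous_intros)
    ultimately show ?thesis
      unfolding \<Phi>_def split_beta by (intro continuous_intros)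
  qed
  ultimately obtain p where p: "p \<in> S" "\<And>q. q \<in> S \<Longrightarrow> (case q of (t, x, y) \<Rightarrow> \<Phi> t x y) \<le> (case p of (t, x, y) \<Rightarrow> \<Phi> t x y)"
    using continuous_attains_sup by metis
  obtain t0 x0 y0 where p_eq: "p = (t0, x0, y0)" by (cases p) auto
  have in_S: "(s, a, b) \<in> S" if "s \<in> {0..\<tau>}" "\<Phi> s a b > 0" for s a b
  proof -
    have "\<not> (\<bar>a\<bar> > R \<or> \<bar>b\<bar> > R)" using \<Phi>_out[OF that(1), of a b] that(2) by linarith
    then show ?thesis using that(1) by (auto simp: S_def abs_le_iff not_less)
  qed
  have max0: "\<Phi> s a b \<le> \<Phi> t0 x0 y0" if "s \<in> {0..\<tau>}" "\<Phi> s a b > 0" for s a b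
    using p(2)[OF in_S[OF that]] by (simp add: p_eq)
  have pos0: "\<Phi> t0 x0 y0 > 0" using max0[OF t \<Phi>_pos] \<Phi>_pos by linarith
  then have max: "\<Phi> s a b \<le> \<Phi> t0 x0 y0" if "s \<in> {0..\<tau>}" for s a b
    using max0[OF that, of a b] by linarith
  have t0: "t0 \<in> {0<..\<tau>}"
  proof -
    have "t0 \<noteq> 0"
    proof
      assume "t0 = 0"
      then have "\<Phi> t0 x0 y0 \<le> 0" using init[of x0 y0] P_pos[of t0 x0 y0] \<epsilon>
        by (simp add: \<Phi>_def) (smt (verit) mult_pos_pos)
      then show False using pos0 by simp
    qed
    then show ?thesis using p(1) by (auto simp: p_eq S_def)
  qed
  let ?E = "\<epsilon> * exp (A * t0)"
  have "((\<lambda>x. \<Phi> t0 x y0) has_real_derivative wx t0 x0 y0 - ?E * (x0 / \<psi> x0)) (at x0)"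
    unfolding \<Phi>_def P_def by (auto intro!: derivative_eq_intros wx t0 \<psi>_deriv)
  then have "wx t0 x0 y0 - ?E * (x0 / \<psi> x0) = 0"
    by (rule DERIV_local_max[where d = 1]) (use max t0 in auto)
  then have wx0: "wx t0 x0 y0 = ?E * (x0 / \<psi> x0)" by simp
  have "((\<lambda>y. \<Phi> t0 x0 y) has_real_derivative wy t0 x0 y0 - ?E * (y0 / \<psi> y0)) (at y0)"
    unfolding \<Phi>_def P_def by (auto intro!: derivative_eq_intros wy t0 \<psi>_deriv)
  then have "wy t0 x0 y0 - ?E * (y0 / \<psi> y0) = 0"
    by (rule DERIV_local_max[where d = 1]) (use max t0 in auto)
  then have wy0: "wy t0 x0 y0 = ?E * (y0 / \<psi> y0)" by simp
  have dt: "((\<lambda>t. \<Phi> t x0 y0) has_real_derivative wt t0 x0 y0 - ?E * A * (\<psi> x0 + \<psi> y0)) (at t0)"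
    unfolding \<Phi>_def P_def by (auto intro!: derivative_eq_intros wt t0)
  \<comment> \<open>The maximum may lie at the final time, so it is compared with earlier times
    only; this still fixes the sign of the time derivative.\<close>
  have "wt t0 x0 y0 - ?E * A * (\<psi> x0 + \<psi> y0) \<ge> 0"
  proof (rule ccontr)
    assume "\<not> ?thesis"
    then obtain d where d: "d > 0" "\<And>h. 0 < h \<Longrightarrow> h < d \<Longrightarrow> \<Phi> t0 x0 y0 < \<Phi> (t0 - h) x0 y0"
      using DERIV_neg_dec_left[OF dt] by auto
    have "\<Phi> t0 x0 y0 < \<Phi> (t0 - min (d / 2) t0) x0 y0"
      using d(1) t0 by (intro d(2)) auto
    moreover have "t0 - min (d / 2) t0 \<in> {0..\<tau>}" using d(1) t0 by auto
    ultimately show False using max by (meson not_less)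
  qed
  moreover have "- (c1 t0 x0 y0 * wx t0 x0 y0) \<le> ?E * C"
  proof -
    have "\<bar>c1 t0 x0 y0 * wx t0 x0 y0\<bar> \<le> C * (?E * 1)"
      unfolding wx0 abs_mult using c(1)[OF t0] \<psi>_deriv_le \<epsilon> C0 t0
      by (intro mult_mono) (auto simp: abs_mult)
    then show ?thesis by (simp add: abs_le_iff mult_ac)
  qed
  moreover have "- (c2 t0 x0 y0 * wy t0 x0 y0) \<le> ?E * C"
  proof -
    have "\<bar>c2 t0 x0 y0 * wy t0 x0 y0\<bar> \<le> C * (?E * 1)"
      unfolding wy0 abs_mult using c(2)[OF t0] \<psi>_deriv_le \<epsilon> C0 t0
      by (intro mult_mono) (auto simp: abs_mult)
    then show ?thesis by (simp add: abs_le_iff mult_ac)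
  qed
  moreover have "?E * A * 2 \<le> ?E * A * (\<psi> x0 + \<psi> y0)"
    using \<psi>_ge(1)[of x0] \<psi>_ge(1)[of y0] \<epsilon> C0 t0 by (intro mult_left_mono) (auto simp: A_def)
  moreover have "?E * A * 2 = ?E * C + ?E * C + 2 * ?E" by (simp add: A_def algebra_simps)
  moreover have "?E > 0" using \<epsilon> by simp
  ultimately show False using ineq[OF t0, of x0 y0] by linarith
qed

text \<open>The sup bound compares \<open>v\<close> with the barriers \<open>H * t\<close> and
  \<open>- H * t\<close>. The slope bound has rate \<open>4 * H\<close>: the source contributes
  \<open>3 * H\<close>, and the variation of \<open>c\<close> contributes at most
  \<open>\<Lambda> * t * 4 * H\<close>, which is at most \<open>H\<close> because
  \<open>\<Lambda> * \<tau> <= 1 / 4\<close>.\<close>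

lemma transport_bounds:
  fixes v vt vx c F :: "real \<Rightarrow> real \<Rightarrow> real"
  assumes cont: "continuous_on ({0..\<tau>} \<times> UNIV) (\<lambda>(t, x). v t x)"
    and bdd: "\<And>t x. t \<in> {0..\<tau>} \<Longrightarrow> \<bar>v t x\<bar> \<le> M"
    and init: "\<And>x. v 0 x = 0"
    and vt: "\<And>t x. t \<in> {0<..\<tau>} \<Longrightarrow> ((\<lambda>t. v t x) has_real_derivative vt t x) (at t)"
    and vx: "\<And>t x. t \<in> {0<..\<tau>} \<Longrightarrow> (v t has_real_derivative vx t x) (at x)"
    and eq: "\<And>t x. t \<in> {0<..\<tau>} \<Longrightarrow> vt t x = - c t x * vx t x - F t x"
    and c_bdd: "\<And>t x. t \<in> {0<..\<tau>} \<Longrightarrow> \<bar>c t x\<bar> \<le> C"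
    and c_lip: "\<And>t x y. t \<in> {0<..\<tau>} \<Longrightarrow> \<bar>c t x - c t y\<bar> \<le> \<Lambda> * \<bar>x - y\<bar>"
    and F_bdd: "\<And>t x. t \<in> {0<..\<tau>} \<Longrightarrow> \<bar>F t x\<bar> \<le> H"
    and F_lip: "\<And>t x y. t \<in> {0<..\<tau>} \<Longrightarrow> \<bar>F t x - F t y\<bar> \<le> 3 * H * \<bar>x - y\<bar>"
    and H: "H \<ge> 0" and \<Lambda>: "\<Lambda> * \<tau> \<le> 1 / 4" "\<Lambda> \<ge> 0"
    and t: "t \<in> {0..\<tau>}"
  shows "\<bar>v t x\<bar> \<le> H * t \<and> \<bar>v t x - v t y\<bar> \<le> 4 * H * t * \<bar>x - y\<bar>"
proof -
  have cont_x: "continuous_on ({0..\<tau>} \<times> UNIV) (\<lambda>(t, x, y::real). v t x)"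
  proof -
    have "continuous_on ({0..\<tau>} \<times> UNIV) (\<lambda>p::real \<times> real \<times> real. (\<lambda>(t, x). v t x) (fst p, fst (snd p)))"
      by (rule continuous_on_compose2[OF cont]) (auto intro!: continuous_intros)
    then show ?thesis by (simp add: split_beta)
  qed
  have cont_y: "continuous_on ({0..\<tau>} \<times> UNIV) (\<lambda>(t, x::real, y). v t y)"
  proof -
    have "continuous_on ({0..\<tau>} \<times> UNIV) (\<lambda>p::real \<times> real \<times> real. (\<lambda>(t, x). v t x) (fst p, snd (snd p)))"
      by (rule continuous_on_compose2[OF cont]) (auto intro!: continuous_intros)
    then show ?thesis by (simp add: split_beta)
  qed
  \<comment> \<open>The second variable is idle with coefficient 0, which must also be bounded by
    the constant; hence \<open>\<bar>C\<bar>\<close> instead of \<open>C\<close>.\<close>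
  have "v t x - H * t \<le> 0"
  proof (rule transport_maximum_principle[where w = "\<lambda>t x y. v t x - H * t" and wt = "\<lambda>t x y. vt t x - H" and wx = "\<lambda>t x y. vx t x"
        and wy = "\<lambda>t x y. 0" and ?c1.0 = "\<lambda>t x y. c t x" and ?c2.0 = "\<lambda>t x y. 0" and C = "\<bar>C\<bar>" and M = M and y = 0, OF _ _ _ _ _ _ _ _ _ t])
    show "continuous_on ({0..\<tau>} \<times> UNIV) (\<lambda>(t, x, y::real). v t x - H * t)"
      using cont_x unfolding split_beta by (intro continuous_intros)
    show "v t x - H * t \<le> M" if "t \<in> {0..\<tau>}" for t x
      using bdd[OF that, of x] that H by (smt (verit) atLeastAtMost_iff mult_nonneg_nonneg)
    show "vt t x - H + c t x * vx t x + 0 * 0 \<le> 0" if "t \<in> {0<..\<tau>}" for t x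
      using eq[OF that, of x] F_bdd[OF that, of x] by (simp add: abs_le_iff)
    show "\<bar>c t x\<bar> \<le> \<bar>C\<bar>" if "t \<in> {0<..\<tau>}" for t x
      using c_bdd[OF that, of x] by linarith
  qed (use init in \<open>auto intro!: derivative_eq_intros vt vx\<close>)
  moreover have "- v t x - H * t \<le> 0"
  proof (rule transport_maximum_principle[where w = "\<lambda>t x y. - v t x - H * t" and wt = "\<lambda>t x y. - vt t x - H" and wx = "\<lambda>t x y. - vx t x"
        and wy = "\<lambda>t x y. 0" and ?c1.0 = "\<lambda>t x y. c t x" and ?c2.0 = "\<lambda>t x y. 0" and C = "\<bar>C\<bar>" and M = M and y = 0, OF _ _ _ _ _ _ _ _ _ t])
    show "continuous_on ({0..\<tau>} \<times> UNIV) (\<lambda>(t, x, y::real). - v t x - H * t)"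
      using cont_x unfolding split_beta by (intro continuous_intros)
    show "- v t x - H * t \<le> M" if "t \<in> {0..\<tau>}" for t x
      using bdd[OF that, of x] that H by (smt (verit) atLeastAtMost_iff mult_nonneg_nonneg)
    show "- vt t x - H + c t x * - vx t x + 0 * 0 \<le> 0" if "t \<in> {0<..\<tau>}" for t x
      using eq[OF that, of x] F_bdd[OF that, of x] by (simp add: abs_le_iff)
    show "\<bar>c t x\<bar> \<le> \<bar>C\<bar>" if "t \<in> {0<..\<tau>}" for t x
      using c_bdd[OF that, of x] by linarith
  qed (use init in \<open>auto intro!: derivative_eq_intros vt vx\<close>)
  ultimately have "\<bar>v t x\<bar> \<le> H * t" by linarith
  txt \<open>The Lipschitz bound is the maximum principle in the doubled variables \<open>(x, y)\<close>, with \<open>\<bar>x - y\<bar>\<close> smoothed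
    to \<open>r\<close>; this avoids differentiating \<open>v\<close> twice.\<close>
  have key: "v t x - v t y \<le> 4 * H * t * sqrt ((x - y)\<^sup>2 + \<eta>\<^sup>2)" if \<eta>: "\<eta> > 0" for \<eta> x y
  proof -
    define r where "r x y = sqrt ((x - y)\<^sup>2 + \<eta>\<^sup>2)" for x y
    have r_pos: "r x y > 0" for x y using \<eta> by (simp add: r_def add_nonneg_pos)
    have r_ge: "\<bar>x - y\<bar> \<le> r x y" for x y by (auto simp: r_def intro!: real_le_rsqrt)
    have half_double: "inverse q / 2 * (2 * a) = a / q" for q a :: real by (cases "q = 0") (simp_all add: field_simps)
    have sq_pos: "(x - y)\<^sup>2 + \<eta>\<^sup>2 > 0" for x y using \<eta> by (simp add: add_nonneg_pos)
    have r_x: "((\<lambda>x. r x y) has_real_derivative (x - y) / r x y) (at x)" for x y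
    proof -
      have "((\<lambda>x. (x - y)\<^sup>2 + \<eta>\<^sup>2) has_real_derivative 2 * (x - y)) (at x)"
        by (auto intro!: derivative_eq_intros)
      then have "((\<lambda>x. sqrt ((x - y)\<^sup>2 + \<eta>\<^sup>2)) has_real_derivative
          inverse (sqrt ((x - y)\<^sup>2 + \<eta>\<^sup>2)) / 2 * (2 * (x - y))) (at x)"
        by (rule DERIV_chain2[where f = sqrt and g = "\<lambda>x. (x - y)\<^sup>2 + \<eta>\<^sup>2", OF DERIV_real_sqrt[OF sq_pos[of x y]]])
      then show ?thesis
        by (simp only: r_def half_double minus_divide_left)
    qed
    have r_y: "((\<lambda>y. r x y) has_real_derivative - ((x - y) / r x y)) (at y)" for x y
    proof -
      have "((\<lambda>y. (x - y)\<^sup>2 + \<eta>\<^sup>2) has_real_derivative 2 * -(x - y)) (at y)"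
        by (auto intro!: derivative_eq_intros)
      then have "((\<lambda>y. sqrt ((x - y)\<^sup>2 + \<eta>\<^sup>2)) has_real_derivative
          inverse (sqrt ((x - y)\<^sup>2 + \<eta>\<^sup>2)) / 2 * (2 * -(x - y))) (at y)"
        by (rule DERIV_chain2[where f = sqrt and g = "\<lambda>y. (x - y)\<^sup>2 + \<eta>\<^sup>2", OF DERIV_real_sqrt[OF sq_pos[of x y]]])
      then show ?thesis
        by (simp only: r_def half_double minus_divide_left)
    qed
    have "v t x - v t y - 4 * H * t * r x y \<le> 0"
    proof (rule transport_maximum_principle[where w = "\<lambda>t x y. v t x - v t y - 4 * H * t * r x y"
          and wt = "\<lambda>t x y. vt t x - vt t y - 4 * H * r x y"
          and wx = "\<lambda>t x y. vx t x - 4 * H * t * ((x - y) / r x y)"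
          and wy = "\<lambda>t x y. - vx t y + 4 * H * t * ((x - y) / r x y)"
          and ?c1.0 = "\<lambda>t x y. c t x" and ?c2.0 = "\<lambda>t x y. c t y" and C = C and M = "2 * M", OF _ _ _ _ _ _ _ _ _ t])
      have "continuous_on ({0..\<tau>} \<times> UNIV) (\<lambda>p::real\<times>real\<times>real. r (fst (snd p)) (snd (snd p)))"
        unfolding r_def by (intro continuous_intros)
      then show "continuous_on ({0..\<tau>} \<times> UNIV) (\<lambda>(t, x, y). v t x - v t y - 4 * H * t * r x y)"
        using cont_x cont_y unfolding split_beta by (intro continuous_intros)
      show "v t x - v t y - 4 * H * t * r x y \<le> 2 * M" if "t \<in> {0..\<tau>}" for t x y
      proof -
        have "4 * H * t * r x y \<ge> 0" using that H r_pos[of x y] by simp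
        then show ?thesis using bdd[OF that, of x] bdd[OF that, of y] by linarith
      qed
      show "vt t x - vt t y - 4 * H * r x y + c t x * (vx t x - 4 * H * t * ((x - y) / r x y)) +
          c t y * (- vx t y + 4 * H * t * ((x - y) / r x y)) \<le> 0" if t: "t \<in> {0<..\<tau>}" for t x y
      proof -
        \<comment> \<open>The slopes of \<open>r\<close> in \<open>x\<close> and \<open>y\<close>
          are opposite, so the barrier sees only the difference of the two coefficients, which is of
          size \<open>\<Lambda> * r\<close>.\<close>
        have "vt t x - vt t y - 4 * H * r x y + c t x * (vx t x - 4 * H * t * ((x - y) / r x y)) +
          c t y * (- vx t y + 4 * H * t * ((x - y) / r x y))
          = - (F t x - F t y) - 4 * H * r x y - (c t x - c t y) * (4 * H * t * ((x - y) / r x y))"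
        proof -
          define q where "q = 4 * H * t * ((x - y) / r x y)"
          show ?thesis
            unfolding q_def[symmetric] eq[OF t] by (simp add: algebra_simps)
        qed
        moreover have "- (F t x - F t y) \<le> 3 * H * r x y"
        proof -
          have "3 * H * \<bar>x - y\<bar> \<le> 3 * H * r x y" using H r_ge by (intro mult_left_mono) auto
          then show ?thesis using F_lip[OF t, of x y] by linarith
        qed
        moreover have "- ((c t x - c t y) * (4 * H * t * ((x - y) / r x y))) \<le> H * r x y"
        proof -
          have "\<bar>(c t x - c t y) * (4 * H * t * ((x - y) / r x y))\<bar> \<le> (\<Lambda> * r x y) * (4 * H * t * 1)"
            unfolding abs_mult
          proof (intro mult_mono)
            show "\<bar>c t x - c t y\<bar> \<le> \<Lambda> * r x y"
              using c_lip[OF t, of x y] mult_left_mono[OF r_ge[of x y] \<Lambda>(2)] by linarith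
            show "\<bar>(x - y) / r x y\<bar> \<le> 1" using r_ge[of x y] r_pos[of x y] by (simp add: abs_divide)
          qed (use H t \<Lambda> r_pos[of x y] in auto)
          also have "\<dots> = (\<Lambda> * t) * (4 * H * r x y)" by simp
          also have "\<dots> \<le> 1 / 4 * (4 * H * r x y)"
          proof (rule mult_right_mono)
            have "\<Lambda> * t \<le> \<Lambda> * \<tau>" using t \<Lambda>(2) by (intro mult_left_mono) auto
            then show "\<Lambda> * t \<le> 1 / 4" using \<Lambda>(1) by linarith
          qed (use H r_pos[of x y] in auto)
          finally show ?thesis by linarith
        qed
        ultimately show ?thesis by linarith
      qed
    qed (use init H r_pos c_bdd in \<open>auto intro!: derivative_eq_intros vt vx r_x r_y simp: less_imp_le\<close>)
    then show ?thesis by (simp add: r_def)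
  qed
  have one: "v t x - v t y \<le> 4 * H * t * \<bar>x - y\<bar>" for x y
  proof (rule tendsto_lowerbound)
    show "((\<lambda>\<eta>. 4 * H * t * sqrt ((x - y)\<^sup>2 + \<eta>\<^sup>2)) \<longlongrightarrow> 4 * H * t * \<bar>x - y\<bar>) (at_right 0)"
      by (auto intro!: tendsto_eq_intros)
    show "\<forall>\<^sub>F \<eta> in at_right 0. v t x - v t y \<le> 4 * H * t * sqrt ((x - y)\<^sup>2 + \<eta>\<^sup>2)"
      using key by (auto simp: eventually_at_right_less intro: eventually_mono[OF eventually_at_right_less])
  qed auto
  have "\<bar>v t x - v t y\<bar> \<le> 4 * H * t * \<bar>x - y\<bar>"
    using one[of x y] one[of y x] by (simp add: abs_le_iff abs_minus_commute)
  with \<open>\<bar>v t x\<bar> \<le> H * t\<close> show ?thesis ..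
qed

subsection \<open>Propagation of the zero state\<close>

text \<open>A derivative is the pointwise limit of difference quotients. This covers
  \<open>u_x\<close>, for which \<open>sobolev_embedding\<close> asserts existence and a bound but
  not continuity.\<close>

lemma deriv_measurable:
  fixes h :: "real \<Rightarrow> real"
  assumes diff: "\<And>x. h field_differentiable at x"
  shows "deriv h \<in> borel_measurable borel"
proof (rule borel_measurable_LIMSEQ_real)
  have [measurable]: "h \<in> borel_measurable borel"
    by (intro borel_measurable_continuous_onI continuous_at_imp_continuous_on ballI
        field_differentiable_imp_continuous_at diff)
  show "(\<lambda>x. (h (x + 1 / real (Suc n)) - h x) / (1 / real (Suc n))) \<in> borel_measurable borel" for n
    by measurable
  fix x
  have "((\<lambda>k. (h (x + k) - h x) / k) \<longlongrightarrow> deriv h x) (at 0)"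
    using diff[of x] by (simp add: field_differentiable_derivI DERIV_def flip: DERIV_deriv_iff_field_differentiable)
  moreover have "filterlim (\<lambda>n. 1 / real (Suc n)) (at 0) sequentially"
    by real_asymp
  ultimately show "(\<lambda>n. (h (x + 1 / real (Suc n)) - h x) / (1 / real (Suc n))) \<longlonglongrightarrow> deriv h x"
    by (rule filterlim_compose)
qed

lemma deriv_le_lipschitz:
  fixes h :: "real \<Rightarrow> real"
  assumes diff: "h field_differentiable at x" and lip: "\<And>y. \<bar>h y - h x\<bar> \<le> B * \<bar>y - x\<bar>"
  shows "\<bar>deriv h x\<bar> \<le> B"
proof (rule tendsto_upperbound)
  show "((\<lambda>y. \<bar>(h y - h x) / (y - x)\<bar>) \<longlongrightarrow> \<bar>deriv h x\<bar>) (at x)"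
    using diff by (intro tendsto_rabs) (simp add: has_field_derivative_iff flip: DERIV_deriv_iff_field_differentiable)
  show "\<forall>\<^sub>F y in at x. \<bar>(h y - h x) / (y - x)\<bar> \<le> B"
    unfolding eventually_at using lip by (auto simp: abs_divide divide_simps intro!: exI[of _ 1])
qed auto

text \<open>Provides the joint continuity demanded by the maximum principle, from continuity in time
  at each fixed point and a Lipschitz bound in space that is uniform in time.\<close>

lemma continuous_on_Times_lipschitz:
  fixes v :: "real \<Rightarrow> real \<Rightarrow> real"
  assumes cont: "\<And>x. continuous_on S (\<lambda>t. v t x)" and lip: "\<And>t x y. t \<in> S \<Longrightarrow> \<bar>v t x - v t y\<bar> \<le> L * \<bar>x - y\<bar>"
  shows "continuous_on (S \<times> UNIV) (\<lambda>(t, x). v t x)"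
  unfolding continuous_on_def
proof safe
  fix t x :: real assume t: "t \<in> S"
  let ?F = "at (t, x) within S \<times> UNIV"
  have fst: "((\<lambda>p. fst p) \<longlongrightarrow> t) ?F" and snd: "((\<lambda>p. snd p) \<longlongrightarrow> x) ?F"
    by (auto intro!: tendsto_eq_intros)
  have "((\<lambda>p. v (fst p) x) \<longlongrightarrow> v t x) ?F"
    by (rule continuous_on_tendsto_compose[OF cont fst t]) (auto simp: eventually_at_filter intro!: always_eventually)
  moreover have "((\<lambda>p. v (fst p) (snd p) - v (fst p) x) \<longlongrightarrow> 0) ?F"
  proof (rule Lim_null_comparison)
    show "\<forall>\<^sub>F p in ?F. norm (v (fst p) (snd p) - v (fst p) x) \<le> L * \<bar>snd p - x\<bar>"
      using lip by (auto simp: eventually_at_filter intro!: always_eventually)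
    show "((\<lambda>p. L * \<bar>snd p - x\<bar>) \<longlongrightarrow> 0) ?F"
      by (auto intro!: tendsto_eq_intros snd)
  qed
  ultimately have "((\<lambda>p. v (fst p) (snd p)) \<longlongrightarrow> v t x) ?F"
    using tendsto_add by fastforce
  then show "((\<lambda>(t, x). v t x) \<longlongrightarrow> v t x) ?F"
    by (simp add: case_prod_unfold)
qed

lemma smooth_differentiable:
  assumes "smooth f"
  shows "f field_differentiable at x" "deriv f field_differentiable at x" "deriv (deriv f) field_differentiable at x"
proof -
  have *: "(deriv ^^ k) f field_differentiable at x" for k
    using assms by (simp add: smooth_def)
  show "f field_differentiable at x" "deriv f field_differentiable at x" "deriv (deriv f) field_differentiable at x"
    using *[of 0] *[of 1] *[of 2] by (simp_all add: numeral_2_eq_2)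
qed

text \<open>Serves the endpoints of the time interval: where \<open>u r\<close> vanishes, the
  difference \<open>u r - u t\<close> is \<open>- u t\<close>.\<close>

lemma sobolev_uminus:
  assumes "h \<in> sobolev s"
  shows "(\<lambda>x. - h x) \<in> sobolev s"
proof -
  obtain F where F: "is_fourier_transform h F" "integrable lborel (\<lambda>\<xi>. (1 + \<xi>\<^sup>2) powr s * (cmod (F \<xi>))\<^sup>2)"
    using assms by (auto simp: sobolev_def)
  have "truncated_fourier (\<lambda>x. - h x) R \<xi> = - truncated_fourier h R \<xi>" for R \<xi>
    by (simp add: truncated_fourier_def set_lebesgue_integral_def)
  then have "cmod (- F \<xi> - truncated_fourier (\<lambda>x. - h x) R \<xi>) = cmod (F \<xi> - truncated_fourier h R \<xi>)" for R \<xi>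
    by (metis minus_diff_minus norm_minus_cancel)
  then have "is_fourier_transform (\<lambda>x. - h x) (\<lambda>\<xi>. - F \<xi>)"
    using F(1) unfolding is_fourier_transform_def square_integrable_def
    by (simp add: truncated_fourier_def)
  then show ?thesis
    using F(2) unfolding sobolev_def by (auto intro!: exI[of _ "\<lambda>\<xi>. - F \<xi>"])
qed

text \<open>The endpoints are the case of interest: a two-sided derivative can be read off from
  inside the interval.\<close>

lemma zero_on_interval_imp_deriv_zero:
  fixes h :: "real \<Rightarrow> real"
  assumes "a < b" "\<And>x. x \<in> {a..b} \<Longrightarrow> h x = 0" "x \<in> {a..b}" "h field_differentiable at x"
  shows "deriv h x = 0"
proof -
  have "(h has_real_derivative deriv h x) (at x within {a..b})"
    using assms(4) by (simp add: field_differentiable_derivI has_field_derivative_at_within)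
  moreover have "(h has_real_derivative 0) (at x within {a..b})"
    by (rule has_field_derivative_transform_within[OF DERIV_const[of 0], of 1]) (use assms in auto)
  moreover have "at x within {a..b} \<noteq> bot"
    using assms(1,3) by (simp add: trivial_limit_within islimpt_Icc)
  ultimately show ?thesis
    unfolding has_field_derivative_iff by (metis tendsto_unique)
qed

lemma continuous_bounded_on_ball:
  fixes \<phi> :: "real \<Rightarrow> real"
  assumes "\<And>z. isCont \<phi> z"
  obtains L where "L \<ge> 0" "\<And>z. \<bar>z\<bar> \<le> M \<Longrightarrow> \<bar>\<phi> z\<bar> \<le> L"
proof -
  have "compact (\<phi> ` {-M..M})"
    using assms by (intro compact_continuous_image continuous_at_imp_continuous_on) auto
  then have "bounded (\<phi> ` {-M..M})" by (rule compact_imp_bounded)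
  then obtain L where L: "\<forall>w\<in>\<phi> ` {-M..M}. norm w \<le> L"
    unfolding bounded_iff by blast
  show ?thesis
  proof (rule that[of "\<bar>L\<bar>"])
    show "\<bar>\<phi> z\<bar> \<le> \<bar>L\<bar>" if "\<bar>z\<bar> \<le> M" for z
      using L[rule_format, of "\<phi> z"] that by (auto simp: abs_le_iff)
  qed simp
qed

lemma abs_diff_le_deriv_bound:
  fixes \<phi> :: "real \<Rightarrow> real"
  assumes "convex S" "\<And>z. \<phi> field_differentiable at z" "\<And>z. z \<in> S \<Longrightarrow> \<bar>deriv \<phi> z\<bar> \<le> L" "a \<in> S" "b \<in> S"
  shows "\<bar>\<phi> a - \<phi> b\<bar> \<le> L * \<bar>a - b\<bar>"
proof -
  have "norm (\<phi> a - \<phi> b) \<le> L * norm (a - b)"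
    using assms by (intro field_differentiable_bound[of S \<phi> "deriv \<phi>"])
      (auto intro!: has_field_derivative_at_within field_differentiable_derivI)
  then show ?thesis by simp
qed

section \<open>The source term of a solution and the set of times at which the solution
  vanishes\<close>

locale sobolev_solution =
  fixes f g :: "real \<Rightarrow> real" and T s :: real and u :: "real \<Rightarrow> real \<Rightarrow> real"
  assumes f: "smooth f" and g: "smooth g" and g_0: "g 0 = 0" and s: "s > 3/2"
    and sol: "is_solution f g T s u"
begin

definition source :: "real \<Rightarrow> real \<Rightarrow> real" where
  "source t y = g (u t y) + deriv (deriv f) (u t y) / 2 * (deriv (u t) y)\<^sup>2"

lemma
  assumes "t \<in> {0..T}"
  shows u_sobolev: "u t \<in> sobolev s" and u_continuous: "continuous_on UNIV (u t)"
    and u_differentiable: "u t field_differentiable at x"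
proof -
  show *: "u t \<in> sobolev s" "continuous_on UNIV (u t)"
    using sol assms by (auto simp: is_solution_def continuous_into_sobolev_def)
  show "u t field_differentiable at x"
    using sobolev_embedding[OF s] * by metis
qed

lemma
  assumes "t \<in> {0<..<T}"
  shows u_time_differentiable: "(\<lambda>\<tau>. u \<tau> x) field_differentiable at t"
    and u_equation: "deriv (\<lambda>\<tau>. u \<tau> x) t = - deriv f (u t x) * deriv (u t) x - dx_inv_helmholtz (source t) x"
proof -
  have "(\<lambda>\<tau>. u \<tau> x) field_differentiable at t \<and> deriv (\<lambda>\<tau>. u \<tau> x) t + deriv f (u t x) * deriv (u t) x
        + dx_inv_helmholtz (source t) x = 0"
    using sol assms unfolding is_solution_def source_def by blast
  then show "(\<lambda>\<tau>. u \<tau> x) field_differentiable at t"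
    "deriv (\<lambda>\<tau>. u \<tau> x) t = - deriv f (u t x) * deriv (u t) x - dx_inv_helmholtz (source t) x"
    by auto
qed

lemma source_measurable:
  assumes t: "t \<in> {0..T}"
  shows "source t \<in> borel_measurable borel"
proof -
  have [measurable]: "u t \<in> borel_measurable borel" "deriv (u t) \<in> borel_measurable borel"
    "g \<in> borel_measurable borel" "deriv (deriv f) \<in> borel_measurable borel"
    using smooth_differentiable[OF f] smooth_differentiable[OF g] u_continuous[OF t] u_differentiable[OF t]
    by (auto intro!: borel_measurable_continuous_onI deriv_measurable continuous_at_imp_continuous_on
        field_differentiable_imp_continuous_at)
  show ?thesis unfolding source_def[abs_def] by measurable
qed

lemma source_bounded:
  assumes t: "t \<in> {0..T}"
  obtains H where "\<And>y. \<bar>source t y\<bar> \<le> H"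
proof -
  obtain C where "\<And>h x. h \<in> sobolev s \<Longrightarrow> continuous_on UNIV h \<Longrightarrow> \<bar>h x\<bar> \<le> C * sobolev_norm s h"
    "\<And>h x. h \<in> sobolev s \<Longrightarrow> continuous_on UNIV h \<Longrightarrow> \<bar>deriv h x\<bar> \<le> C * sobolev_norm s h"
    by (rule sobolev_embedding[OF s]) blast
  then obtain M where M: "\<And>x. \<bar>u t x\<bar> \<le> M" "\<And>x. \<bar>deriv (u t) x\<bar> \<le> M"
    using u_sobolev[OF t] u_continuous[OF t] by metis
  obtain G where G: "\<And>z. \<bar>z\<bar> \<le> M \<Longrightarrow> \<bar>g z\<bar> \<le> G"
    using continuous_bounded_on_ball[of g M] smooth_differentiable[OF g] field_differentiable_imp_continuous_at by metis
  obtain L where L: "L \<ge> 0" "\<And>z. \<bar>z\<bar> \<le> M \<Longrightarrow> \<bar>deriv (deriv f) z\<bar> \<le> L"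
    using continuous_bounded_on_ball[of "deriv (deriv f)" M] smooth_differentiable[OF f] field_differentiable_imp_continuous_at by metis
  show ?thesis
  proof (rule that)
    fix y
    have "\<bar>deriv (deriv f) (u t y) / 2 * (deriv (u t) y)\<^sup>2\<bar> \<le> L / 2 * M\<^sup>2"
      unfolding abs_mult using L M(1)[of y] power_mono[OF M(2)[of y], of 2] by (intro mult_mono) auto
    then show "\<bar>source t y\<bar> \<le> G + L / 2 * M\<^sup>2"
      unfolding source_def using G[OF M(1)[of y]] by linarith
  qed
qed

text \<open>While \<open>\<bar>u\<bar>\<close> and \<open>\<bar>u\<^sub>x\<bar>\<close> are at most 1, the source is dominated by \<open>\<bar>u\<bar> + \<bar>u\<^sub>x\<bar>\<close>. A bound \<open>H\<close> on the
  source over a short time interval around \<open>t0\<close> therefore improves to \<open>H / 2\<close>, so the source vanishes there.\<close>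

lemma vanishing_is_open:
  assumes t0: "t0 \<in> {0<..<T}" and zero: "\<And>x. u t0 x = 0"
  obtains \<delta> where "\<delta> > 0" "\<And>t x. \<bar>t - t0\<bar> \<le> \<delta> \<Longrightarrow> u t x = 0"
proof -
  obtain C where C: "\<And>h x. h \<in> sobolev s \<Longrightarrow> continuous_on UNIV h \<Longrightarrow> \<bar>h x\<bar> \<le> C * sobolev_norm s h"
    "\<And>h x. h \<in> sobolev s \<Longrightarrow> continuous_on UNIV h \<Longrightarrow> \<bar>deriv h x\<bar> \<le> C * sobolev_norm s h"
    by (rule sobolev_embedding[OF s]) blast
  have "t0 \<in> {0..T}" using t0 by simp
  then have "((\<lambda>t. sobolev_norm s (\<lambda>x. u t x - u t0 x)) \<longlongrightarrow> 0) (at t0 within {0..T})"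
    using sol by (auto simp: is_solution_def continuous_into_sobolev_def)
  then have "((\<lambda>t. C * sobolev_norm s (u t)) \<longlongrightarrow> 0) (at t0 within {0..T})"
    by (simp add: zero tendsto_mult_right_zero)
  then have "\<forall>\<^sub>F t in at t0 within {0..T}. C * sobolev_norm s (u t) < 1"
    by (rule order_tendstoD) simp
  then obtain d where d: "d > 0" "\<And>t. t \<in> {0..T} \<Longrightarrow> t \<noteq> t0 \<Longrightarrow> \<bar>t - t0\<bar> < d \<Longrightarrow> C * sobolev_norm s (u t) < 1"
    by (auto simp: eventually_at dist_real_def)
  have small: "\<bar>u t x\<bar> \<le> 1" "\<bar>deriv (u t) x\<bar> \<le> 1" if "t \<in> {0..T}" "\<bar>t - t0\<bar> < d" for t x
  proof -
    \<comment> \<open>The punctured limit says nothing at \<open>t0\<close> itself, where the bounds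
      hold because \<open>u\<close> vanishes.\<close>
    have "u t0 = (\<lambda>x. 0)" using zero by auto
    then have "\<bar>u t x\<bar> \<le> 1 \<and> \<bar>deriv (u t) x\<bar> \<le> 1" if "t = t0" using that by simp
    moreover have "\<bar>u t x\<bar> \<le> 1 \<and> \<bar>deriv (u t) x\<bar> \<le> 1" if "t \<noteq> t0"
      using C[OF u_sobolev u_continuous, of t x] d(2)[of t] that \<open>t \<in> {0..T}\<close> \<open>\<bar>t - t0\<bar> < d\<close> by force
    ultimately show "\<bar>u t x\<bar> \<le> 1" "\<bar>deriv (u t) x\<bar> \<le> 1" by auto
  qed
  obtain L where L: "L \<ge> 0" "\<And>z. \<bar>z\<bar> \<le> 1 \<Longrightarrow> \<bar>deriv f z\<bar> \<le> L" "\<And>z. \<bar>z\<bar> \<le> 1 \<Longrightarrow> \<bar>deriv (deriv f) z\<bar> \<le> L"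
      "\<And>z. \<bar>z\<bar> \<le> 1 \<Longrightarrow> \<bar>deriv g z\<bar> \<le> L"
  proof -
    note cont = smooth_differentiable(2,3)[THEN field_differentiable_imp_continuous_at]
    obtain L1 where L1: "L1 \<ge> 0" "\<And>z. \<bar>z\<bar> \<le> 1 \<Longrightarrow> \<bar>deriv f z\<bar> \<le> L1"
      using continuous_bounded_on_ball[OF cont(1)[OF f]] by blast
    obtain L2 where L2: "L2 \<ge> 0" "\<And>z. \<bar>z\<bar> \<le> 1 \<Longrightarrow> \<bar>deriv (deriv f) z\<bar> \<le> L2"
      using continuous_bounded_on_ball[OF cont(2)[OF f]] by blast
    obtain L3 where L3: "L3 \<ge> 0" "\<And>z. \<bar>z\<bar> \<le> 1 \<Longrightarrow> \<bar>deriv g z\<bar> \<le> L3"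
      using continuous_bounded_on_ball[OF cont(1)[OF g]] by blast
    show ?thesis
      by (rule that[of "L1 + L2 + L3"]) (use L1 L2 L3 in \<open>fastforce+\<close>)
  qed
  have source_le: "\<bar>source t x\<bar> \<le> L * (\<bar>u t x\<bar> + \<bar>deriv (u t) x\<bar>)" if "t \<in> {0..T}" "\<bar>t - t0\<bar> < d" for t x
  proof -
    note sm = small[OF that, of x]
    have "\<bar>g (u t x) - g 0\<bar> \<le> L * \<bar>u t x - 0\<bar>"
      by (rule abs_diff_le_deriv_bound[of "{-1..1}"])
         (use L sm smooth_differentiable(1)[OF g] in \<open>auto simp: abs_le_iff\<close>)
    moreover have "\<bar>deriv (deriv f) (u t x) / 2 * (deriv (u t) x)\<^sup>2\<bar> \<le> L * \<bar>deriv (u t) x\<bar>"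
    proof -
      have "(deriv (u t) x)\<^sup>2 \<le> \<bar>deriv (u t) x\<bar>"
        using mult_left_mono[OF sm(2), of "\<bar>deriv (u t) x\<bar>"] by (simp add: power2_eq_square)
      moreover have "\<bar>deriv (deriv f) (u t x) / 2\<bar> \<le> L"
        using L(1) L(3)[OF sm(1)] by simp
      ultimately show ?thesis unfolding abs_mult using L(1) by (intro mult_mono) auto
    qed
    ultimately show ?thesis unfolding source_def g_0 by (simp add: distrib_left)
  qed
  \<comment> \<open>The first three entries keep \<open>|u|\<close> and \<open>|u_x|\<close> at most
    1 and the times inside \<open>(0, T)\<close>. The last gives
    \<open>10 * L * \<tau> <= 1\<close>: one round costs \<open>L\<close> from
    \<open>source_le\<close> times \<open>1 + 4\<close> from \<open>transport_bounds\<close>, so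
    \<open>5 * L * H * \<tau> <= H / 2\<close>. Using \<open>L + 1\<close> avoids dividing by
    0.\<close>
  define \<tau> where "\<tau> = min (min (d / 2) (t0 / 2)) (min ((T - t0) / 2) (1 / (10 * (L + 1))))"
  have \<tau>: "\<tau> > 0" "\<tau> < d" "\<tau> < t0" "\<tau> < T - t0"
    using d(1) t0 L(1) by (auto simp: \<tau>_def min_less_iff_disj)
  have L\<tau>: "10 * L * \<tau> \<le> 1"
  proof -
    have "10 * L * \<tau> \<le> 10 * L * (1 / (10 * (L + 1)))"
      using L(1) by (intro mult_left_mono) (auto simp: \<tau>_def)
    also have "\<dots> \<le> 1" using L(1) by (simp add: divide_simps)
    finally show ?thesis .
  qed
  \<comment> \<open>The sign \<open>\<sigma>\<close> selects the direction of time. Reversal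
    multiplies the transport coefficient and the source by \<open>\<sigma>\<close>, which leaves all
    their bounds unchanged, so one forward estimate covers both directions.\<close>
  have main: "u (t0 + \<sigma> * t) x = 0" if \<sigma>: "\<sigma> \<in> {-1, 1}" and t: "t \<in> {0..\<tau>}" for \<sigma> t x
  proof -
    have near: "t0 + \<sigma> * t \<in> {0<..<T}" "t0 + \<sigma> * t \<in> {0..T}" "\<bar>t0 + \<sigma> * t - t0\<bar> < d" if "t \<in> {0..\<tau>}" for t
      using \<sigma> that \<tau> by auto
    define v where "v t = u (t0 + \<sigma> * t)" for t
    have v_lip: "\<bar>v t x - v t y\<bar> \<le> 1 * \<bar>x - y\<bar>" if "t \<in> {0..\<tau>}" for t x y
      unfolding v_def using small[OF near(2,3)[OF that]] u_differentiable[OF near(2)[OF that]]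
      by (intro abs_diff_le_deriv_bound[of UNIV]) auto
    have v_t: "((\<lambda>t. v t x) has_real_derivative \<sigma> * deriv (\<lambda>\<tau>. u \<tau> x) (t0 + \<sigma> * t)) (at t)" if "t \<in> {0..\<tau>}" for t x
    proof -
      have "((\<lambda>\<tau>. u \<tau> x) has_real_derivative deriv (\<lambda>\<tau>. u \<tau> x) (t0 + \<sigma> * t)) (at (t0 + \<sigma> * t))"
        using u_time_differentiable[OF near(1)[OF that]] by (simp add: field_differentiable_derivI)
      moreover have "((\<lambda>t. t0 + \<sigma> * t) has_real_derivative \<sigma>) (at t)"
        by (auto intro!: derivative_eq_intros)
      ultimately show ?thesis
        unfolding v_def using DERIV_chain2 by (fastforce simp: mult.commute)
    qed
    have v_cont: "continuous_on ({0..\<tau>} \<times> UNIV) (\<lambda>(t, x). v t x)"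
      by (rule continuous_on_Times_lipschitz[OF _ v_lip])
         (use DERIV_isCont[OF v_t] in \<open>auto intro!: continuous_at_imp_continuous_on\<close>)
    have improve: "\<bar>v t x\<bar> \<le> H * t" "\<bar>deriv (v t) x\<bar> \<le> 4 * H * t"
      if H: "H \<ge> 0" "\<And>t x. t \<in> {0..\<tau>} \<Longrightarrow> \<bar>source (t0 + \<sigma> * t) x\<bar> \<le> H" and t: "t \<in> {0..\<tau>}" for H t x
    proof -
      have bounds: "\<bar>v t x\<bar> \<le> H * t \<and> \<bar>v t x - v t y\<bar> \<le> 4 * H * t * \<bar>x - y\<bar>" for x y
      proof (rule transport_bounds[OF v_cont, where vt = "\<lambda>t x. \<sigma> * deriv (\<lambda>\<tau>. u \<tau> x) (t0 + \<sigma> * t)"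
              and vx = "\<lambda>t. deriv (v t)" and c = "\<lambda>t x. \<sigma> * deriv f (v t x)" and M = 1 and C = L and \<Lambda> = L
              and F = "\<lambda>t x. \<sigma> * dx_inv_helmholtz (source (t0 + \<sigma> * t)) x"])
        show "\<bar>v t x\<bar> \<le> 1" if "t \<in> {0..\<tau>}" for t x
          unfolding v_def by (rule small[OF near(2,3)[OF that]])
        show "v 0 x = 0" for x by (simp add: v_def zero)
        show "((\<lambda>t. v t x) has_real_derivative \<sigma> * deriv (\<lambda>\<tau>. u \<tau> x) (t0 + \<sigma> * t)) (at t)" if "t \<in> {0<..\<tau>}" for t x
          using v_t that by auto
        show "(v t has_real_derivative deriv (v t) x) (at x)" if "t \<in> {0<..\<tau>}" for t x
          unfolding v_def using that by (intro field_differentiable_derivI u_differentiable near(2)) auto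
        show "\<sigma> * deriv (\<lambda>\<tau>. u \<tau> x) (t0 + \<sigma> * t) =
            - (\<sigma> * deriv f (v t x)) * deriv (v t) x - \<sigma> * dx_inv_helmholtz (source (t0 + \<sigma> * t)) x" if "t \<in> {0<..\<tau>}" for t x
          using near(1)[of t] that unfolding v_def by (simp add: u_equation algebra_simps)
        show "\<bar>\<sigma> * deriv f (v t x)\<bar> \<le> L" if "t \<in> {0<..\<tau>}" for t x
          using L(2)[OF small(1)[OF near(2,3), of t x]] that \<sigma> by (auto simp: v_def abs_mult)
        show "\<bar>\<sigma> * deriv f (v t x) - \<sigma> * deriv f (v t y)\<bar> \<le> L * \<bar>x - y\<bar>" if "t \<in> {0<..\<tau>}" for t x y
        proof -
          have v1: "\<bar>v t x\<bar> \<le> 1" for x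
            unfolding v_def using that by (intro small near) auto
          have "\<bar>deriv f (v t x) - deriv f (v t y)\<bar> \<le> L * \<bar>v t x - v t y\<bar>"
            by (rule abs_diff_le_deriv_bound[of "{-1..1}"])
               (use L(3) v1[of x] v1[of y] smooth_differentiable(2)[OF f] in \<open>auto simp: abs_le_iff\<close>)
          also have "\<dots> \<le> L * \<bar>x - y\<bar>"
            using v_lip[of t x y] that L(1) by (intro mult_left_mono) auto
          finally show ?thesis using \<sigma> by (auto simp: abs_minus_commute)
        qed
        have src: "source (t0 + \<sigma> * t) \<in> borel_measurable borel" "\<And>y. \<bar>source (t0 + \<sigma> * t) y\<bar> \<le> H" if "t \<in> {0<..\<tau>}" for t
          using that by (auto intro!: source_measurable near(2) H(2))
        show "\<bar>\<sigma> * dx_inv_helmholtz (source (t0 + \<sigma> * t)) x\<bar> \<le> H" if "t \<in> {0<..\<tau>}" for t x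
          using dx_inv_helmholtz_bound[OF src[OF that], of x] \<sigma> by (auto simp: abs_mult)
        show "\<bar>\<sigma> * dx_inv_helmholtz (source (t0 + \<sigma> * t)) x - \<sigma> * dx_inv_helmholtz (source (t0 + \<sigma> * t)) y\<bar> \<le> 3 * H * \<bar>x - y\<bar>"
          if "t \<in> {0<..\<tau>}" for t x y
          using dx_inv_helmholtz_lipschitz[OF src[OF that], of x y] \<sigma> by (auto simp: abs_minus_commute)
      qed (use H(1) L(1) L\<tau> t in auto)
      then show "\<bar>v t x\<bar> \<le> H * t" by blast
      show "\<bar>deriv (v t) x\<bar> \<le> 4 * H * t"
        using bounds u_differentiable[OF near(2)[OF t]] by (intro deriv_le_lipschitz) (auto simp: v_def)
    qed
    \<comment> \<open>The start \<open>2 * L\<close> reflects \<open>|u| + |u_x| <= 2\<close>; each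
      round through \<open>improve\<close> and \<open>source_le\<close> halves the bound.\<close>
    have source_pow: "\<forall>t\<in>{0..\<tau>}. \<forall>x. \<bar>source (t0 + \<sigma> * t) x\<bar> \<le> 2 * L / 2 ^ n" for n
    proof (induction n)
      case 0
      show ?case
      proof safe
        fix t x assume t: "t \<in> {0..\<tau>}"
        have "L * (\<bar>v t x\<bar> + \<bar>deriv (v t) x\<bar>) \<le> L * (1 + 1)"
          unfolding v_def using L(1) by (intro mult_left_mono add_mono small near t)
        then show "\<bar>source (t0 + \<sigma> * t) x\<bar> \<le> 2 * L / 2 ^ 0"
          using source_le[OF near(2,3)[OF t], of x] by (simp add: v_def)
      qed
    next
      case (Suc n)
      define H where "H = 2 * L / 2 ^ n"
      have H: "H \<ge> 0" using L(1) by (simp add: H_def)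
      show ?case
      proof safe
        fix t x assume t: "t \<in> {0..\<tau>}"
        have "\<bar>v t x\<bar> + \<bar>deriv (v t) x\<bar> \<le> H * t + 4 * H * t"
          using Suc H t by (intro add_mono improve) (auto simp: H_def)
        also have "\<dots> = 5 * H * t" by simp
        also have "\<dots> \<le> 5 * H * \<tau>" using t H by (intro mult_left_mono) auto
        finally have "L * (\<bar>v t x\<bar> + \<bar>deriv (v t) x\<bar>) \<le> L * (5 * H * \<tau>)"
          using L(1) by (intro mult_left_mono)
        also have "\<dots> = 10 * L * \<tau> * (H / 2)" by simp
        also have "\<dots> \<le> 1 * (H / 2)" using L\<tau> H by (intro mult_right_mono) auto
        finally show "\<bar>source (t0 + \<sigma> * t) x\<bar> \<le> 2 * L / 2 ^ Suc n"
          using source_le[OF near(2,3)[OF t], of x] by (simp add: v_def H_def)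
      qed
    qed
    have "\<bar>v t x\<bar> \<le> 2 * L / 2 ^ n * t" for n
      using source_pow[of n] L(1) t by (intro improve) auto
    moreover have "(\<lambda>n. 2 * L / 2 ^ n * t) \<longlonglongrightarrow> 0"
      by real_asymp
    ultimately have "\<bar>v t x\<bar> \<le> 0"
      by (intro LIMSEQ_le_const) auto
    then show ?thesis by (simp add: v_def)
  qed
  show ?thesis
  proof (rule that[OF \<tau>(1)])
    fix t x assume "\<bar>t - t0\<bar> \<le> \<tau>"
    then show "u t x = 0"
      using main[of 1 "t - t0" x] main[of "-1" "t0 - t" x] by (cases "t \<ge> t0") auto
  qed
qed

text \<open>A connectedness argument: the zero times are open by \<open>vanishing_is_open\<close>,
  and relatively closed because \<open>u\<close> is continuous in time at each point.\<close>

lemma vanishing_propagates: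
  assumes t0: "t0 \<in> {0<..<T}" and zero: "\<And>x. u t0 x = 0" and t: "t \<in> {0<..<T}"
  shows "u t x = 0"
proof -
  define Z where "Z = {t \<in> {0<..<T}. \<forall>x. u t x = 0}"
  have "open Z"
    unfolding open_dist
  proof safe
    fix t assume t: "t \<in> Z"
    then obtain \<delta> where \<delta>: "\<delta> > 0" "\<And>r x. \<bar>r - t\<bar> \<le> \<delta> \<Longrightarrow> u r x = 0"
      using vanishing_is_open[of t] by (auto simp: Z_def)
    show "\<exists>e>0. \<forall>r. dist r t < e \<longrightarrow> r \<in> Z"
    proof (intro exI[of _ "min \<delta> (min t (T - t))"] conjI allI impI)
      fix r assume "dist r t < min \<delta> (min t (T - t))"
      then show "r \<in> Z" using \<delta>(2)[of r] t by (auto simp: Z_def dist_real_def)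
    qed (use \<delta>(1) t in \<open>auto simp: Z_def\<close>)
  qed
  moreover have "closedin (top_of_set {0<..<T}) Z"
  proof -
    have "continuous_on {0<..<T} (\<lambda>t. u t x)" for x
      using u_time_differentiable by (intro continuous_at_imp_continuous_on ballI field_differentiable_imp_continuous_at)
    then have "closedin (top_of_set {0<..<T}) ({0<..<T} \<inter> (\<lambda>t. u t x) -` {0})" for x
      by (intro continuous_closedin_preimage) auto
    then have "closedin (top_of_set {0<..<T}) (\<Inter>x. {0<..<T} \<inter> (\<lambda>t. u t x) -` {0})"
      by (intro closedin_INT) auto
    moreover have "(\<Inter>x. {0<..<T} \<inter> (\<lambda>t. u t x) -` {0}) = Z" by (auto simp: Z_def)
    ultimately show ?thesis by simp
  qed
  moreover have "connected {0<..<T}" by simp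
  moreover have "t0 \<in> Z" using t0 zero by (simp add: Z_def)
  moreover have "Z \<subseteq> {0<..<T}" by (auto simp: Z_def)
  ultimately have "Z = {0<..<T}"
    unfolding connected_clopen by (metis empty_iff openin_open_eq open_greaterThanLessThan)
  then show ?thesis using t by (auto simp: Z_def)
qed

text \<open>The equation holds on the open interval only, so at an endpoint continuity into the
  Sobolev space takes over: the norm of \<open>- u t\<close>, constant in the approaching time, must
  have limit 0.\<close>

lemma vanishing_propagates_closed:
  assumes t0: "t0 \<in> {0<..<T}" and zero: "\<And>x. u t0 x = 0" and t: "t \<in> {0..T}"
  shows "u t x = 0"
proof (cases "t \<in> {0<..<T}")
  case True
  then show ?thesis using vanishing_propagates[OF t0 zero] by blast
next
  case False
  obtain C where C: "\<And>h x. h \<in> sobolev s \<Longrightarrow> continuous_on UNIV h \<Longrightarrow> \<bar>h x\<bar> \<le> C * sobolev_norm s h"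
    by (rule sobolev_embedding[OF s]) blast
  let ?F = "at t within {0..T}"
  \<comment> \<open>As \<open>t\<close> is an endpoint, every other point of \<open>[0, T]\<close>
    closer to it than \<open>T\<close> is interior.\<close>
  have "\<forall>\<^sub>F r in ?F. r \<in> {0<..<T}"
    unfolding eventually_at using t t0 False
    by (intro exI[of _ T]) (auto simp: dist_real_def)
  then have "\<forall>\<^sub>F r in ?F. sobolev_norm s (\<lambda>x. u r x - u t x) = sobolev_norm s (\<lambda>x. - u t x)"
    by eventually_elim (simp add: vanishing_propagates[OF t0 zero])
  moreover have "((\<lambda>r. sobolev_norm s (\<lambda>x. u r x - u t x)) \<longlongrightarrow> 0) ?F"
    using sol t by (auto simp: is_solution_def continuous_into_sobolev_def)
  ultimately have "((\<lambda>r. sobolev_norm s (\<lambda>x. - u t x)) \<longlongrightarrow> 0) ?F"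
    by (simp cong: tendsto_cong)
  moreover have "?F \<noteq> bot"
  proof -
    have "t islimpt {0..T}" using t t0 by (simp add: islimpt_Icc)
    then show ?thesis by (simp add: trivial_limit_within)
  qed
  ultimately have "sobolev_norm s (\<lambda>x. - u t x) = 0"
    by (simp add: tendsto_const_iff)
  moreover have "\<bar>- u t x\<bar> \<le> C * sobolev_norm s (\<lambda>x. - u t x)"
    by (intro C sobolev_uminus u_sobolev t continuous_on_minus u_continuous)
  ultimately show ?thesis by simp
qed

end

section \<open>Vanishing on an interval forces vanishing everywhere\<close>

theorem corollary2p2:
  fixes f g :: "real \<Rightarrow> real" and T s :: real and u :: "real \<Rightarrow> real \<Rightarrow> real"
  assumes "smooth f" and "smooth g"
    and "f 0 = 0" and "\<forall>x. deriv (deriv f) x \<ge> 0"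
    and "\<forall>x. g x \<ge> 0" and "\<forall>x. g x = 0 \<longleftrightarrow> x = 0"
    and "T > 0" and "s > 3/2"
    and "is_solution f g T s u"
    and "\<exists>t\<in>{0..T}. \<exists>x. u t x \<noteq> 0"
  shows "\<not> (\<exists>t\<in>{0<..<T}. \<exists>a b. a < b \<and> (\<forall>x\<in>{a..b}. u t x = 0) \<and>
           deriv (\<lambda>\<tau>. u \<tau> a) t = deriv (\<lambda>\<tau>. u \<tau> b) t)"
proof
  assume "\<exists>t\<in>{0<..<T}. \<exists>a b. a < b \<and> (\<forall>x\<in>{a..b}. u t x = 0) \<and>
           deriv (\<lambda>\<tau>. u \<tau> a) t = deriv (\<lambda>\<tau>. u \<tau> b) t"
  then obtain t a b where t: "t \<in> {0<..<T}" and ab: "a < b" and zero: "\<And>x. x \<in> {a..b} \<Longrightarrow> u t x = 0"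
    and u_t: "deriv (\<lambda>\<tau>. u \<tau> a) t = deriv (\<lambda>\<tau>. u \<tau> b) t"
    by blast
  interpret sobolev_solution f g T s u
    using assms by unfold_locales auto
  have t': "t \<in> {0..T}" using t by simp
  have deriv_zero: "deriv (u t) x = 0" if "x \<in> {a..b}" for x
    using zero_on_interval_imp_deriv_zero[OF ab zero that u_differentiable[OF t']] by blast
  obtain H where H: "\<And>y. \<bar>source t y\<bar> \<le> H"
    using source_bounded[OF t'] by blast
  \<comment> \<open>Convexity of \<open>f\<close> enters here. The inequality is used twice: it
    makes the source nonnegative, and a zero of the source then forces \<open>g (u t y) = 0\<close>,
    hence \<open>u t y = 0\<close>.\<close>
  have g_le: "g (u t y) \<le> source t y" for y
    using assms(4) by (simp add: source_def)
  have "AE y in lborel. source t y = 0"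
  proof (rule dx_inv_helmholtz_eq_imp_zero[OF source_measurable[OF t'] H _ ab])
    show "source t y \<ge> 0" for y
      using g_le[of y] assms(5) by (meson order_trans)
    show "source t y = 0" if "y \<in> {a..b}" for y
      using zero[OF that] deriv_zero[OF that] g_0 by (simp add: source_def)
    show "dx_inv_helmholtz (source t) a = dx_inv_helmholtz (source t) b"
      using u_t ab by (simp add: u_equation[OF t] zero deriv_zero)
  qed
  then have "AE y in lborel. u t y = 0"
  proof eventually_elim
    case (elim y)
    then show ?case using g_le[of y] assms(5,6) by (metis order_antisym)
  qed
  \<comment> \<open>The zero set is closed by continuity and has a null complement; a nonempty open
    set is never null, so the zero set is the whole line.\<close>
  then have "u t y = 0" for y
  proof -
    have "closed {y. u t y = 0}"
      using continuous_closed_vimage[of "{0}" "u t"] u_continuous[OF t']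
      by (simp add: vimage_def continuous_on_eq_continuous_at)
    from mem_closed_if_AE_lebesgue_open[OF open_UNIV this] \<open>AE y in lborel. u t y = 0\<close> show ?thesis
      by (auto simp: AE_completion)
  qed
  then show False
    using vanishing_propagates_closed[OF t] assms(10) by blast
qed

end
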